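(* Let $0<\nu<2$, and let $F\not\equiv 0$ be real and even. Assume that $F$ is either a polynomial or an entire function of order at most one, and that $\mathcal Z(F)\subseteq S_{\mathfrak h_{1,\nu}^{\mathrm{opt}}}$. Then $$\mathscr M_{F,\nu}\bigl(y(y+t)\bigr)\in\mathcal E_2\qquad\text{for all } t\in\mathbb R,$$ and hence $\mathscr M_{F,\nu}(y)\preceq\mathscr M_{F,\nu}(y^2)$. The strip constant is optimal: for every $H>\mathfrak h_{1,\nu}^{\mathrm{opt}}$ there is a nonzero real even polynomial $F$ with $\mathcal Z(F)\subseteq S_H$ for which $\mathscr M_{F,\nu}(y)\preceq\mathscr M_{F,\nu}(y^2)$ (and hence the inclusion above) fails. The two branches $\alpha_{\mathrm{rep}}(\nu)$ and $\alpha_{\mathrm{sing}}(\nu)$ meet at $$\nu_0=\frac{\sqrt{17}-1}{4},$$ and $$\mathfrak h_{1,\nu}^{\mathrm{opt}}=\begin{cases}\sqrt{\dfrac14-\alpha_{\mathrm{rep}}(\nu)},&0<\nu\le\nu_0,\\[2mm]\sqrt{\dfrac14-\dfrac{2(\nu-2)}{\nu+2}},&\nu_0<\nu<2.\end{cases}$$ In particular, $\mathfrak h_{1,1/2}^{\mathrm{opt}}=1.065615\ldots$ and $\mathfrak h_{1,3/2}^{\mathrm{opt}}=\sqrt{15/28}$.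
   Context: A polynomial or entire function $H$ is called real if $H(\overline u)=\overline{H(u)}$. $\mathcal Z(H)$ is the zero set of $H$, and $S_h=\{u\in\mathbb C: |\operatorname{Re} u|\le h\}$. Threshold: for $0<\nu<2$ put $$\mathfrak p_\nu(\alpha)=(\nu+3)\alpha^4+28\alpha^3+(88-34\nu)\alpha^2+(112-56\nu)\alpha+48-24\nu.$$ This polynomial has exactly one zero in $(-1,-3/4)$, denoted $\alpha_{\mathrm{rep}}(\nu)$. Put $$\alpha_{\mathrm{sing}}(\nu)=\frac{2(\nu-2)}{\nu+2},\qquad \alpha_\sharp(\nu)=\max\{\alpha_{\mathrm{rep}}(\nu),\alpha_{\mathrm{sing}}(\nu)\},\qquad \mathfrak h_{1,\nu}^{\mathrm{opt}}=\sqrt{\tfrac14-\alpha_\sharp(\nu)}.$$ Jacobi multiplier: let $$\mathscr J_\nu=y(y-4)\frac{d^2}{dy^2}+(2y-4\nu)\frac{d}{dy},$$ and for $r\ge 0$ let $\mathsf P_r^{(\nu)}\in\mathbb R[y]$ be its unique monic eigenpolynomial of degree $r$, with $\mathscr J_\nu\mathsf P_r^{(\nu)}=r(r+1)\mathsf P_r^{(\nu)}$. The linear operator $\mathscr M_{F,\nu}:\mathbb R[y]\to\mathbb R[y]$ is defined by $\mathscr M_{F,\nu}\mathsf P_r^{(\nu)}=F(r+1/2)\,\mathsf P_r^{(\nu)}$ for all $r\ge 0$. $\mathcal E_2$ consists of the zero polynomial and all nonzero $P\in\mathbb R[y]$ of degree at most $2$ having at most one complex zero outside the real interval $[0,4]$,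 counted with multiplicity. Weak Obreschkoff relation: for real polynomials $A,B$, write $A\preceq B$ if every nonzero polynomial of the form $B+tA$, $t\in\mathbb R$, has only real zeros (nonzero constants count as real-rooted). Conventions: $0\preceq 0$, and $0\preceq B$ and $B\preceq 0$ for every nonzero real-rooted polynomial $B$. *)

theory Defs
  imports "HOL-Complex_Analysis.Complex_Analysis" "HOL-Library.Landau_Symbols"
begin

section \<open>Real entire functions with zeros in a vertical strip\<close>

definition real_function :: "(complex \<Rightarrow> complex) \<Rightarrow> bool" where
  "real_function F \<longleftrightarrow> (\<forall>u. F (cnj u) = cnj (F u))"

definition even_function :: "(complex \<Rightarrow> complex) \<Rightarrow> bool" where
  "even_function F \<longleftrightarrow> (\<forall>u. F (- u) = F u)"

definition polynomial_function_C :: "(complex \<Rightarrow> complex) \<Rightarrow> bool" where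
  "polynomial_function_C F \<longleftrightarrow> (\<exists>q :: complex poly. F = poly q)"

definition zero_set :: "(complex \<Rightarrow> complex) \<Rightarrow> complex set" where
  "zero_set F = {u. F u = 0}"

definition vstrip :: "real \<Rightarrow> complex set" where
  "vstrip h = {u. \<bar>Re u\<bar> \<le> h}"

text \<open>
  The order of an entire function: the infimum of the exponents \<open>\<rho> \<ge> 0\<close> for which
  \<open>F(z) = O(exp (|z| ^ \<rho>))\<close> as \<open>z\<close> tends to infinity (infinity if there is no such exponent).
\<close>
definition growth_order :: "(complex \<Rightarrow> complex) \<Rightarrow> ereal" where
  "growth_order F =
     Inf {ereal \<rho> | \<rho>. 0 \<le> \<rho> \<and>
            F \<in> O[at_infinity](\<lambda>z. complex_of_real (exp (norm z powr \<rho>)))}"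

section \<open>The threshold\<close>

definition rep_poly :: "real \<Rightarrow> real \<Rightarrow> real" where
  "rep_poly \<nu> \<alpha> = (\<nu> + 3) * \<alpha> ^ 4 + 28 * \<alpha> ^ 3 + (88 - 34 * \<nu>) * \<alpha> ^ 2
                   + (112 - 56 * \<nu>) * \<alpha> + 48 - 24 * \<nu>"

definition alpha_rep :: "real \<Rightarrow> real" where
  "alpha_rep \<nu> = (THE \<alpha>. \<alpha> \<in> {-1 <..< -3/4} \<and> rep_poly \<nu> \<alpha> = 0)"

definition alpha_sing :: "real \<Rightarrow> real" where
  "alpha_sing \<nu> = 2 * (\<nu> - 2) / (\<nu> + 2)"

definition alpha_sharp :: "real \<Rightarrow> real" where
  "alpha_sharp \<nu> = max (alpha_rep \<nu>) (alpha_sing \<nu>)"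

definition h_opt :: "real \<Rightarrow> real" where
  "h_opt \<nu> = sqrt (1/4 - alpha_sharp \<nu>)"

lemma ex1_alpha_rep:
  assumes "0 < \<nu>" "\<nu> < 2"
  shows "\<exists>!\<alpha>. \<alpha> \<in> {-1 <..< -3/4} \<and> rep_poly \<nu> \<alpha> = 0"
proof -
  have mono: "rep_poly \<nu> a < rep_poly \<nu> b" if ab: "-1 \<le> a" "a < b" "b \<le> -3/4" for a b
  proof (rule DERIV_pos_imp_increasing[OF ab(2)])
    fix x assume x: "a \<le> x" "x \<le> b"
    let ?d = "(4 * \<nu> + 12) * x ^ 3 + 84 * x ^ 2 + (176 - 68 * \<nu>) * x + (112 - 56 * \<nu>)"
    have d: "(rep_poly \<nu> has_real_derivative ?d) (at x)"
      unfolding rep_poly_def[abs_def]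
      by (rule derivative_eq_intros refl | simp add: algebra_simps)+
    define s where "s = - x"
    have s: "3/4 \<le> s" "s \<le> 1" using x ab by (auto simp: s_def)
    define d0 where "d0 = -12 * s ^ 3 + 84 * s ^ 2 - 176 * s + 112"
    define d2 where "d2 = -20 * s ^ 3 + 84 * s ^ 2 - 40 * s"
    have dd: "?d = (1 - \<nu>/2) * d0 + (\<nu>/2) * d2"
      by (simp add: d0_def d2_def s_def field_simps power2_eq_square power3_eq_cube)
    have "d0 = (1 - s) * (12 * s ^ 2 - 72 * s + 104) + 8"
      by (simp add: d0_def algebra_simps power2_eq_square power3_eq_cube)
    moreover have "12 * s ^ 2 - 72 * s + 104 > 0"
      using s(2) zero_le_power2[of s] by linarith
    ultimately have "d0 > 0" using s by (simp add: add_nonneg_pos)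
    have "d2 = 4 * s * ((1 - s) * (5 * s - 16) + 6)"
      by (simp add: d2_def algebra_simps power2_eq_square power3_eq_cube)
    moreover have "(1 - s) * (5 * s - 16) + 6 > 0"
    proof -
      have "(1 - s) * (16 - 5 * s) \<le> (1/4) * 16"
        using s by (intro mult_mono) auto
      then show ?thesis by (simp add: algebra_simps)
    qed
    ultimately have "d2 > 0" using s by simp
    have "?d > 0" unfolding dd using \<open>d0 > 0\<close> \<open>d2 > 0\<close> assms by (simp add: add_pos_pos)
    with d show "\<exists>y. (rep_poly \<nu> has_real_derivative y) (at x) \<and> 0 < y" by blast
  qed
  have lo: "rep_poly \<nu> (-1) < 0" and hi: "rep_poly \<nu> (-3/4) > 0"
    using assms by (auto simp: rep_poly_def power_divide field_simps)
  have "\<exists>x\<ge>-1. x \<le> -3/4 \<and> rep_poly \<nu> x = 0"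
    by (rule IVT) (use lo hi in \<open>auto simp: rep_poly_def[abs_def] intro!: continuous_intros\<close>)
  then obtain x where x: "-1 \<le> x" "x \<le> -3/4" "rep_poly \<nu> x = 0" by blast
  with lo hi have "x \<noteq> -1" "x \<noteq> -3/4" by auto
  with x have x': "x \<in> {-1 <..< -3/4}" by auto
  show ?thesis
  proof (rule ex1I[of _ x])
    show "y = x" if "y \<in> {-1 <..< -3/4} \<and> rep_poly \<nu> y = 0" for y
      using mono[of x y] mono[of y x] x that by (cases x y rule: linorder_cases) auto
  qed (use x x' in auto)
qed

section \<open>The Jacobi multiplier\<close>

definition jacobi_op :: "real \<Rightarrow> real poly \<Rightarrow> real poly" where
  "jacobi_op \<nu> p = [:0, -4, 1:] * pderiv (pderiv p) + [:- 4 * \<nu>, 2:] * pderiv p"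

definition jacobi_eigenpoly :: "real \<Rightarrow> nat \<Rightarrow> real poly" where
  "jacobi_eigenpoly \<nu> r =
     (THE p. degree p = r \<and> lead_coeff p = 1 \<and>
             jacobi_op \<nu> p = smult (of_nat r * (of_nat r + 1)) p)"

text \<open>
  The multiplier is applied to real functions only, whose values at the real points
  \<open>r + 1/2\<close> are real, so that the projection \<open>Re\<close> loses nothing.
\<close>
definition multiplier_op :: "(complex \<Rightarrow> complex) \<Rightarrow> real \<Rightarrow> real poly \<Rightarrow> real poly" where
  "multiplier_op F \<nu> =
     (THE L. Vector_Spaces.linear smult smult L \<and>
        (\<forall>r. L (jacobi_eigenpoly \<nu> r)
               = smult (Re (F (of_nat r + 1/2))) (jacobi_eigenpoly \<nu> r)))"

lemma coeff_jacobi_op: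
  "coeff (jacobi_op \<nu> p) n =
     of_nat n * (of_nat n + 1) * coeff p n - 4 * (of_nat n + 1) * (of_nat n + \<nu>) * coeff p (Suc n)"
  by (cases n; cases "n - 1")
     (auto simp: jacobi_op_def coeff_pderiv algebra_simps coeff_pCons split: nat.splits)

lemma ex1_jacobi_eigenpoly:
  "\<exists>!p. degree p = r \<and> lead_coeff p = 1 \<and>
        jacobi_op \<nu> p = smult (of_nat r * (of_nat r + 1)) p"
proof -
  define lam where "lam n = (of_nat n * (of_nat n + 1) :: real)" for n :: nat
  have lam_neq: "lam n - lam r \<noteq> 0" if "n < r" for n
  proof -
    have "n * (n + 1) < r * (r + 1)" using that by (intro mult_strict_mono) auto
    then have "real (n * (n + 1)) < real (r * (r + 1))" using of_nat_less_iff by blast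
    then show ?thesis by (simp add: lam_def algebra_simps)
  qed
  have eig: "jacobi_op \<nu> p = smult (of_nat r * (of_nat r + 1)) p \<longleftrightarrow>
      (\<forall>n. (lam n - lam r) * coeff p n = 4 * (of_nat n + 1) * (of_nat n + \<nu>) * coeff p (Suc n))"
    for p
    unfolding poly_eq_iff coeff_jacobi_op by (simp add: lam_def algebra_simps)
  define w where "w k = 4 * (of_nat k + 1) * (of_nat k + \<nu>) / (lam k - lam r)" for k :: nat
  define c where "c n = (\<Prod>k = n..<r. w k)" for n
  define p where "p = (\<Sum>n\<le>r. monom (c n) n)"
  have cp: "coeff p n = (if n \<le> r then c n else 0)" for n
    by (simp add: p_def coeff_sum)
  have "c r = 1" by (simp add: c_def)
  then have deg: "degree p = r"
    by (intro antisym degree_le le_degree) (auto simp: cp)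
  show ?thesis
  proof (rule ex1I[of _ p])
    have "(lam n - lam r) * coeff p n = 4 * (of_nat n + 1) * (of_nat n + \<nu>) * coeff p (Suc n)"
      for n
    proof (cases "n < r")
      case True
      then have "c n = w n * c (Suc n)"
        by (simp add: c_def prod.atLeast_Suc_lessThan)
      with True lam_neq[OF True] show ?thesis by (simp add: cp w_def)
    qed (auto simp: cp not_less le_less)
    with deg \<open>c r = 1\<close> show "degree p = r \<and> lead_coeff p = 1 \<and>
        jacobi_op \<nu> p = smult (of_nat r * (of_nat r + 1)) p"
      unfolding eig by (simp add: cp)
  next
    fix q
    assume q: "degree q = r \<and> lead_coeff q = 1 \<and>
        jacobi_op \<nu> q = smult (of_nat r * (of_nat r + 1)) q"
    have cq: "coeff q n = c n" if "n \<le> r" for n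
      using that
    proof (induction n rule: inc_induct)
      case base
      then show ?case using q \<open>c r = 1\<close> by auto
    next
      case (step n)
      from q have "(lam n - lam r) * coeff q n
          = 4 * (of_nat n + 1) * (of_nat n + \<nu>) * coeff q (Suc n)"
        unfolding eig by blast
      with step lam_neq[of n] have "coeff q n = w n * c (Suc n)"
        by (simp add: w_def field_simps)
      with step show ?case by (simp add: c_def prod.atLeast_Suc_lessThan)
    qed
    show "q = p"
      by (rule poly_eqI) (use q in \<open>auto simp: cp cq coeff_eq_0\<close>)
  qed
qed

lemma jacobi_eigenpoly:
  shows degree_jacobi_eigenpoly: "degree (jacobi_eigenpoly \<nu> r) = r"
    and lead_coeff_jacobi_eigenpoly: "lead_coeff (jacobi_eigenpoly \<nu> r) = 1"
    and jacobi_op_eigenpoly: "jacobi_op \<nu> (jacobi_eigenpoly \<nu> r)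
           = smult (of_nat r * (of_nat r + 1)) (jacobi_eigenpoly \<nu> r)"
  using theI'[OF ex1_jacobi_eigenpoly[of r \<nu>]] unfolding jacobi_eigenpoly_def by auto

lemma vector_space_pair_smult:
  "vector_space_pair (smult :: real \<Rightarrow> real poly \<Rightarrow> real poly) (smult :: real \<Rightarrow> real poly \<Rightarrow> real poly)"
  by unfold_locales (auto simp: algebra_simps smult_add_right smult_add_left)

lemma ex1_multiplier_op:
  "\<exists>!L. Vector_Spaces.linear smult smult L \<and>
        (\<forall>r. L (jacobi_eigenpoly \<nu> r)
               = smult (Re (F (of_nat r + 1/2))) (jacobi_eigenpoly \<nu> r))"
proof -
  interpret V: vector_space_pair "smult :: real \<Rightarrow> real poly \<Rightarrow> real poly"
      "smult :: real \<Rightarrow> real poly \<Rightarrow> real poly"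
    by (rule vector_space_pair_smult)
  let ?P = "jacobi_eigenpoly \<nu>"
  have span: "p \<in> V.vs1.span (range ?P)" for p
  proof (induction "degree p" arbitrary: p rule: less_induct)
    case less
    let ?r = "degree p"
    define q where "q = p - smult (lead_coeff p) (?P ?r)"
    have Pin: "smult c (?P ?r) \<in> V.vs1.span (range ?P)" for c
      by (intro V.vs1.span_scale V.vs1.span_base) auto
    have "q \<in> V.vs1.span (range ?P)"
    proof (cases "?r = 0 \<or> q = 0")
      case True
      have "q = 0"
      proof (cases "?r = 0")
        case True
        then have "coeff q n = 0" for n
          using lead_coeff_jacobi_eigenpoly[of \<nu> 0] degree_jacobi_eigenpoly[of \<nu> 0]
          by (cases n) (auto simp: q_def coeff_eq_0)
        then show ?thesis by (simp add: poly_eq_iff)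
      qed (use True in auto)
      then show ?thesis by (simp add: V.vs1.span_zero)
    next
      case False
      have "degree q \<le> ?r"
        unfolding q_def
        by (intro degree_diff_le) (auto intro: order.trans[OF degree_smult_le]
             simp: degree_jacobi_eigenpoly)
      moreover have "coeff q ?r = 0"
        using lead_coeff_jacobi_eigenpoly[of \<nu> ?r] by (simp add: q_def degree_jacobi_eigenpoly)
      ultimately have "degree q < ?r"
        using False by (metis leading_coeff_0_iff order_le_less)
      then show ?thesis by (rule less)
    qed
    from V.vs1.span_add[OF this Pin[of "lead_coeff p"]] show ?case by (simp add: q_def)
  qed
  have indep: "\<not> V.vs1.dependent (range ?P)"
  proof
    assume "V.vs1.dependent (range ?P)"
    then obtain t u where t: "finite t" "t \<subseteq> range ?P" "(\<Sum>v\<in>t. smult (u v) v) = 0"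
      and "\<exists>v\<in>t. u v \<noteq> 0"
      unfolding V.vs1.dependent_explicit by blast
    then have "finite {v\<in>t. u v \<noteq> 0}" "{v\<in>t. u v \<noteq> 0} \<noteq> {}" by auto
    from Max_in[OF finite_imageI[of _ degree, OF this(1)]] this(2)
    obtain v where v: "v \<in> t" "u v \<noteq> 0" "degree v = Max (degree ` {v\<in>t. u v \<noteq> 0})"
      by force
    have mx: "degree w \<le> degree v" if "w \<in> t" "u w \<noteq> 0" for w
      unfolding v(3) using that t(1) by (intro Max_ge) auto
    have vP: "w = ?P (degree w)" if "w \<in> t" for w
      using that t(2) by (auto simp: degree_jacobi_eigenpoly)
    have "u w * coeff w (degree v) = 0" if "w \<in> t - {v}" for w
    proof (cases "u w = 0")
      case False
      then have "degree w \<le> degree v" using mx that by auto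
      moreover have "degree w \<noteq> degree v" using vP[of w] vP[of v] that v by auto
      ultimately show ?thesis by (simp add: coeff_eq_0)
    qed simp
    then have z: "(\<Sum>w\<in>t - {v}. u w * coeff w (degree v)) = 0" by (intro sum.neutral) auto
    have "0 = coeff (\<Sum>v\<in>t. smult (u v) v) (degree v)" using t(3) by simp
    also have "\<dots> = (\<Sum>w\<in>t. u w * coeff w (degree v))" by (simp add: coeff_sum)
    also have "\<dots> = u v * lead_coeff v"
      using sum.remove[OF t(1) v(1), of "\<lambda>w. u w * coeff w (degree v)"] z by simp
    also have "lead_coeff v = 1"
      using vP[OF v(1)] lead_coeff_jacobi_eigenpoly[of \<nu> "degree v"] by metis
    finally show False using v(2) by simp
  qed
  obtain L :: "real poly \<Rightarrow> real poly" where L: "Vector_Spaces.linear smult smult L"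
    "\<forall>x\<in>range ?P. L x = smult (Re (F (of_nat (degree x) + 1/2))) x"
    using V.linear_independent_extend[OF indep,
        of "\<lambda>x. smult (Re (F (of_nat (degree x) + 1/2))) x"] by blast
  show ?thesis
  proof (rule ex1I[of _ L])
    show "Vector_Spaces.linear smult smult L \<and>
        (\<forall>r. L (?P r) = smult (Re (F (of_nat r + 1/2))) (?P r))"
      using L by (auto simp: degree_jacobi_eigenpoly)
  next
    fix K
    assume K: "Vector_Spaces.linear smult smult K \<and>
        (\<forall>r. K (?P r) = smult (Re (F (of_nat r + 1/2))) (?P r))"
    show "K = L"
    proof
      fix p
      show "K p = L p"
        by (rule V.linear_eq_on[OF _ _ span[of p]])
           (use K L in \<open>auto simp: degree_jacobi_eigenpoly\<close>)
    qed
  qed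
qed

lemma multiplier_op:
  shows linear_multiplier_op: "Vector_Spaces.linear smult smult (multiplier_op F \<nu>)"
    and multiplier_op_eigenpoly: "multiplier_op F \<nu> (jacobi_eigenpoly \<nu> r)
           = smult (Re (F (of_nat r + 1/2))) (jacobi_eigenpoly \<nu> r)"
  using theI'[OF ex1_multiplier_op[of \<nu> F]] unfolding multiplier_op_def by auto

section \<open>The class of quadratics and the weak Obreschkoff relation\<close>

abbreviation cpoly :: "real poly \<Rightarrow> complex poly" where
  "cpoly p \<equiv> map_poly complex_of_real p"

definition zeros_outside :: "real poly \<Rightarrow> complex set" where
  "zeros_outside P = {z. poly (cpoly P) z = 0 \<and> z \<notin> complex_of_real ` {0..4}}"

definition E2 :: "real poly set" where
  "E2 = {P. P = 0 \<or> (degree P \<le> 2 \<and> (\<Sum>z\<in>zeros_outside P. order z (cpoly P)) \<le> 1)}"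

definition only_real_zeros :: "real poly \<Rightarrow> bool" where
  "only_real_zeros p \<longleftrightarrow> (\<forall>z :: complex. poly (cpoly p) z = 0 \<longrightarrow> z \<in> \<real>)"

definition weak_obreschkoff :: "real poly \<Rightarrow> real poly \<Rightarrow> bool"  (infix "\<preceq>\<^sub>O" 50) where
  "A \<preceq>\<^sub>O B \<longleftrightarrow> (\<forall>t. B + smult t A \<noteq> 0 \<longrightarrow> only_real_zeros (B + smult t A))"

text \<open>The usual conventions for the zero polynomial are instances of the definition.\<close>

lemma weak_obreschkoff_zero:
  "0 \<preceq>\<^sub>O 0"
  "B \<noteq> 0 \<Longrightarrow> 0 \<preceq>\<^sub>O B \<longleftrightarrow> only_real_zeros B"
  "B \<noteq> 0 \<Longrightarrow> B \<preceq>\<^sub>O 0 \<longleftrightarrow> only_real_zeros B"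
proof -
  have cp: "poly (cpoly (smult t p)) z = of_real t * poly (cpoly p) z" for t p z
    by (simp add: map_poly_smult)
  show "0 \<preceq>\<^sub>O 0" "B \<noteq> 0 \<Longrightarrow> 0 \<preceq>\<^sub>O B \<longleftrightarrow> only_real_zeros B"
    by (auto simp: weak_obreschkoff_def)
  show "B \<noteq> 0 \<Longrightarrow> B \<preceq>\<^sub>O 0 \<longleftrightarrow> only_real_zeros B"
    unfolding weak_obreschkoff_def only_real_zeros_def cp
    by (auto simp: only_real_zeros_def cp dest: spec[of _ 1])
qed

end

theory Submission
  imports Defs "HOL-Real_Asymp.Real_Asymp"
begin

text \<open>
  Only \<open>a = F(1/2)/F(3/2)\<close> and \<open>b = F(5/2)/F(3/2)\<close> enter. The linear polynomial \<open>M(y)\<close> vanishes at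
  \<open>y\<^sub>0 = 2 \<nu> (1 - a)\<close>, all members of the pencil \<open>M(y\<^sup>2) + t M(y)\<close> agree there, and evaluating at \<open>y\<^sub>0\<close>, \<open>0\<close>
  and \<open>4\<close> turns the claim into inequalities between \<open>a\<close> and \<open>b\<close>. These inequalities are multiplicative:
  it suffices to check them on real zeros, on pairs of negative contributions and on pairs
  of conjugate zeros. A single zero yields the bound \<open>\<alpha>\<^sub>s\<^sub>i\<^sub>n\<^sub>g\<close>, a double one \<open>\<alpha>\<^sub>r\<^sub>e\<^sub>p\<close>, and polynomials \<open>(u\<^sup>2 - c)\<^sup>k\<close>
  with \<open>k \<le> 2\<close> show sharpness. An even entire function of order at most one is an entire function of
  order at most \<open>1/2\<close> in \<open>u\<^sup>2\<close>, hence a limit of products over its zeros, and the inequalities are closed.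
\<close>

section \<open>The threshold\<close>

text \<open>The obstacle is the sign of \<open>a\<close>. A real zero with \<alpha> < 0 contributes
  a negative factor, and for negative \<open>a\<close> the inequalities bound \<open>b\<close> only
  from below, so by themselves they do not multiply. Two negative factors together behave like one
  nonnegative pair; however many occur, at most one is left over after pairing. This is why single
  and double zeros already decide the threshold, and why it is a maximum of two branches. A
  conjugate pair approaching the real line degenerates to a double real zero, so it leads to the
  same quartic. On the analytic side, growth of order below one in u^2 leaves no room for an
  exponential factor. The working variable is u^2 - 9/4: the reference value F(3/2) then sits at the
  origin, where every product over zeros is normalized to 1, and F(1/2), F(5/2) become values at -2
  and 4.\<close>

lemma rep_poly_continuous: "continuous_on S (rep_poly \<nu>)"
  unfolding rep_poly_def[abs_def] by (intro continuous_intros)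

lemma alpha_rep:
  assumes "0 < \<nu>" "\<nu> < 2"
  shows alpha_rep_bounds: "-1 < alpha_rep \<nu>" "alpha_rep \<nu> < -3/4"
    and rep_poly_alpha_rep: "rep_poly \<nu> (alpha_rep \<nu>) = 0"
  using theI'[OF ex1_alpha_rep[OF assms]] unfolding alpha_rep_def by auto

lemma alpha_rep_unique:
  assumes "0 < \<nu>" "\<nu> < 2" "-1 < x" "x < -3/4" "rep_poly \<nu> x = 0"
  shows "x = alpha_rep \<nu>"
  using ex1_alpha_rep[OF assms(1,2)] assms alpha_rep[OF assms(1,2)]
  by (metis greaterThanLessThan_iff)

lemma rep_poly_neg:
  assumes \<nu>: "0 < \<nu>" "\<nu> < 2" and x: "-1 \<le> x" "x < alpha_rep \<nu>"
  shows "rep_poly \<nu> x < 0"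
proof (rule ccontr)
  assume "\<not> rep_poly \<nu> x < 0"
  moreover have "rep_poly \<nu> (-1) < 0" using \<nu> by (simp add: rep_poly_def)
  ultimately obtain z where z: "-1 \<le> z" "z \<le> x" "rep_poly \<nu> z = 0"
    using IVT'[of "rep_poly \<nu>" "-1" 0 x] rep_poly_continuous x by auto
  then have "z \<noteq> -1" using \<open>rep_poly \<nu> (-1) < 0\<close> by auto
  with alpha_rep_unique[OF \<nu>, of z] z x alpha_rep_bounds[OF \<nu>] show False by auto
qed

lemma rep_poly_pos_right:
  assumes \<nu>: "0 < \<nu>" "\<nu> < 2" and x: "-3/4 \<le> x" "x \<le> 1/4"
  shows "rep_poly \<nu> x > 0"
proof -
  \<comment> \<open>The quartic is affine in \<nu>; \<open>p\<close> and \<open>r\<close> are its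
    values at \<nu> = 0 and \<nu> = 2. Strictness comes from \<open>p\<close>, since
    \<open>r\<close> vanishes at x = 0.\<close>
  define p where "p = 3 * x ^ 4 + 28 * x ^ 3 + 88 * x ^ 2 + 112 * x + 48"
  define r where "r = x ^ 2 * (5 * x ^ 2 + 28 * x + 20)"
  have "rep_poly \<nu> x = (1 - \<nu> / 2) * p + \<nu> / 2 * r"
    by (simp add: rep_poly_def p_def r_def field_simps power2_eq_square power3_eq_cube power4_eq_xxxx)
  moreover have "p > 0"
  proof -
    define t where "t = x + 3/4"
    have "p = 3 * t ^ 4 + 19 * t ^ 3 + 281/8 * t\<^sup>2 + 355/16 * t + 675/256"
      by (simp add: p_def t_def power2_eq_square power3_eq_cube power4_eq_xxxx field_simps)
    also have "\<dots> > 0" using x by (intro add_nonneg_pos add_nonneg_nonneg) (auto simp: t_def)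
    finally show ?thesis .
  qed
  moreover have "r \<ge> 0"
  proof -
    have "5 * x ^ 2 + 28 * x + 20 = (x + 3/4) * (5 * x + 97/4) + 29/16"
      by (simp add: field_simps power2_eq_square)
    moreover have "(x + 3/4) * (5 * x + 97/4) \<ge> 0" using x by (intro mult_nonneg_nonneg) auto
    ultimately show ?thesis by (simp add: r_def)
  qed
  ultimately show ?thesis using \<nu> by (simp add: add_pos_nonneg)
qed

lemma rep_poly_pos:
  assumes \<nu>: "0 < \<nu>" "\<nu> < 2" and x: "alpha_rep \<nu> < x" "x \<le> 1/4"
  shows "rep_poly \<nu> x > 0"
proof (rule ccontr)
  assume neg: "\<not> rep_poly \<nu> x > 0"
  have pos: "rep_poly \<nu> (-3/4) > 0" by (rule rep_poly_pos_right[OF \<nu>]) auto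
  from neg x have "x < -3/4" using rep_poly_pos_right[OF \<nu>, of x] by linarith
  with neg pos obtain z where z: "x \<le> z" "z \<le> -3/4" "rep_poly \<nu> z = 0"
    using IVT'[of "rep_poly \<nu>" x 0 "-3/4"] rep_poly_continuous by auto
  then have "z \<noteq> -3/4" using pos by auto
  with alpha_rep_unique[OF \<nu>, of z] z x alpha_rep_bounds[OF \<nu>] show False by auto
qed

text \<open>The constant lies just below the root of the quartic at \<nu> = 0. The bound -1 would be
  too weak for conjugate zeros: there both endpoint values \<open>p\<close>, \<open>r\<close> of the
  coefficient \<open>c1\<close> are negative at -1.\<close>

lemma alpha_rep_gt:
  assumes \<nu>: "0 < \<nu>" "\<nu> < 2"
  shows "alpha_rep \<nu> > -91/100"
proof (rule ccontr)
  assume *: "\<not> ?thesis"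
  have "rep_poly \<nu> (-91/100) < 0"
    using \<nu> by (simp add: rep_poly_def power2_eq_square power3_eq_cube power4_eq_xxxx field_simps)
  then show False
    using * rep_poly_pos[OF \<nu>, of "-91/100"] rep_poly_alpha_rep[OF \<nu>]
    by (cases "alpha_rep \<nu> = -91/100") auto
qed

section \<open>Comparison of the two branches\<close>

lemma rep_poly_alpha_sing:
  assumes "0 < \<nu>" "\<nu> < 2"
  shows "rep_poly \<nu> (alpha_sing \<nu>) * (2 + \<nu>) ^ 4
       = 128 * (2 - \<nu>) * \<nu> * (\<nu> + 1) * (2 * \<nu>\<^sup>2 + \<nu> - 2)"
proof -
  define s where "s = alpha_sing \<nu>"
  have s: "s * (2 + \<nu>) = 2 * (\<nu> - 2)" using assms by (simp add: s_def alpha_sing_def add.commute)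
  \<comment> \<open>Distributing powers of the denominator \<open>e\<close> keeps \<open>s\<close>
    inside products \<open>s * e\<close>, which are polynomials in \<nu>; no fraction
    remains.\<close>
  define e where "e = 2 + \<nu>"
  have \<nu>: "\<nu> = e - 2" by (simp add: e_def)
  have "rep_poly \<nu> s * e ^ 4 = (\<nu> + 3) * (s * e) ^ 4 + 28 * (s * e) ^ 3 * e
      + (88 - 34 * \<nu>) * (s * e) ^ 2 * e ^ 2 + (112 - 56 * \<nu>) * (s * e) * e ^ 3 + (48 - 24 * \<nu>) * e ^ 4"
    by (simp add: rep_poly_def algebra_simps power2_eq_square power3_eq_cube power4_eq_xxxx)
  also have "\<dots> = 128 * (2 - \<nu>) * \<nu> * (\<nu> + 1) * (2 * \<nu>\<^sup>2 + \<nu> - 2)"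
    unfolding s[folded e_def] unfolding \<nu>
    by (simp add: algebra_simps power2_eq_square power3_eq_cube power4_eq_xxxx)
  finally show ?thesis by (simp add: s_def e_def)
qed

lemma nu0_quadratic:
  fixes \<nu> :: real
  shows "2 * \<nu>\<^sup>2 + \<nu> - 2 = 2 * (\<nu> - (sqrt 17 - 1) / 4) * (\<nu> + (sqrt 17 + 1) / 4)"
  by (simp add: algebra_simps power2_eq_square add_divide_distrib diff_divide_distrib)

lemma sign_rep_poly_alpha_sing:
  assumes "0 < \<nu>" "\<nu> < 2"
  shows "sgn (rep_poly \<nu> (alpha_sing \<nu>)) = sgn (\<nu> - (sqrt 17 - 1) / 4)"
proof -
  have "sgn (rep_poly \<nu> (alpha_sing \<nu>) * (2 + \<nu>) ^ 4) = sgn (\<nu> - (sqrt 17 - 1) / 4)"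
    unfolding rep_poly_alpha_sing[OF assms] nu0_quadratic sgn_mult
    using assms by (simp add: add_pos_pos)
  then show ?thesis using assms by (simp add: sgn_mult)
qed

lemma nu0_bounds: "2/3 < (sqrt 17 - 1) / 4" "(sqrt 17 - 1) / 4 < (1::real)"
proof -
  have "sqrt 17 > 4" by (rule real_less_rsqrt) auto
  then show "2/3 < (sqrt 17 - 1) / (4::real)" by simp
  have "sqrt 17 < 5" by (rule real_less_lsqrt) auto
  then show "(sqrt 17 - 1) / 4 < (1::real)" by simp
qed

text \<open>The sign of the quartic left of \<open>alpha_rep\<close> is known only from -1 on; the
  lower bound 2/3 in \<open>nu0_bounds\<close> puts \<open>alpha_sing\<close> into that range at the
  crossing and beyond.\<close>

lemma alpha_sing_gt:
  assumes "2/3 < \<nu>"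
  shows "alpha_sing \<nu> > -1"
  using assms by (simp add: alpha_sing_def field_simps)

lemma alpha_sing_neg: "0 < \<nu> \<Longrightarrow> \<nu> < 2 \<Longrightarrow> alpha_sing \<nu> < 0"
  by (simp add: alpha_sing_def divide_less_0_iff)

text \<open>Between -1 and 1/4 the quartic changes sign only at \<open>alpha_rep\<close>, so its
  sign at \<open>alpha_sing\<close> tells on which side that point lies.\<close>

lemma alpha_sing_le_rep_iff:
  assumes \<nu>: "0 < \<nu>" "\<nu> < 2"
  shows "alpha_sing \<nu> \<le> alpha_rep \<nu> \<longleftrightarrow> \<nu> \<le> (sqrt 17 - 1) / 4"
proof
  assume le: "alpha_sing \<nu> \<le> alpha_rep \<nu>"
  show "\<nu> \<le> (sqrt 17 - 1) / 4"
  proof (rule ccontr)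
    assume *: "\<not> ?thesis"
    then have "rep_poly \<nu> (alpha_sing \<nu>) > 0"
      using sign_rep_poly_alpha_sing[OF \<nu>] by (simp add: sgn_if split: if_splits)
    moreover have "alpha_sing \<nu> > -1" using * nu0_bounds by (intro alpha_sing_gt) auto
    ultimately show False using rep_poly_neg[OF \<nu>, of "alpha_sing \<nu>"] rep_poly_alpha_rep[OF \<nu>] le
      by (cases "alpha_sing \<nu> = alpha_rep \<nu>") auto
  qed
next
  assume "\<nu> \<le> (sqrt 17 - 1) / 4"
  then have "rep_poly \<nu> (alpha_sing \<nu>) \<le> 0"
    using sign_rep_poly_alpha_sing[OF \<nu>] by (simp add: sgn_if split: if_splits)
  then show "alpha_sing \<nu> \<le> alpha_rep \<nu>"
    using rep_poly_pos[OF \<nu>, of "alpha_sing \<nu>"] alpha_sing_neg[OF \<nu>] by linarith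
qed

lemma alpha_rep_eq_sing_iff:
  assumes \<nu>: "0 < \<nu>" "\<nu> < 2"
  shows "alpha_rep \<nu> = alpha_sing \<nu> \<longleftrightarrow> \<nu> = (sqrt 17 - 1) / 4"
proof
  assume "alpha_rep \<nu> = alpha_sing \<nu>"
  then have "rep_poly \<nu> (alpha_sing \<nu>) = 0" using rep_poly_alpha_rep[OF \<nu>] by simp
  then show "\<nu> = (sqrt 17 - 1) / 4"
    using sign_rep_poly_alpha_sing[OF \<nu>] by (simp add: sgn_if split: if_splits)
next
  assume *: "\<nu> = (sqrt 17 - 1) / 4"
  then have le: "alpha_sing \<nu> \<le> alpha_rep \<nu>" using alpha_sing_le_rep_iff[OF \<nu>] by simp
  have "rep_poly \<nu> (alpha_sing \<nu>) = 0"
    using sign_rep_poly_alpha_sing[OF \<nu>] unfolding * by (simp add: sgn_if split: if_splits)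
  moreover have "alpha_sing \<nu> > -1" using * nu0_bounds by (intro alpha_sing_gt) auto
  ultimately show "alpha_rep \<nu> = alpha_sing \<nu>"
    using rep_poly_neg[OF \<nu>, of "alpha_sing \<nu>"] le by force
qed

lemma alpha_sharp_bounds:
  assumes \<nu>: "0 < \<nu>" "\<nu> < 2"
  shows "-91/100 < alpha_sharp \<nu>" "alpha_sharp \<nu> < 0"
  using alpha_rep_gt[OF \<nu>] alpha_rep_bounds[OF \<nu>] alpha_sing_neg[OF \<nu>]
  by (auto simp: alpha_sharp_def)

lemma rep_poly_nonneg_sharp:
  assumes \<nu>: "0 < \<nu>" "\<nu> < 2" and "alpha_sharp \<nu> \<le> x" "x \<le> 1/4"
  shows "rep_poly \<nu> x \<ge> 0"
  using rep_poly_pos[OF \<nu>, of x] assms rep_poly_alpha_rep[OF \<nu>]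
  by (cases "x = alpha_rep \<nu>") (auto simp: alpha_sharp_def)

lemma h_opt_sq:
  assumes \<nu>: "0 < \<nu>" "\<nu> < 2"
  shows "h_opt \<nu> \<ge> 0" "(h_opt \<nu>)\<^sup>2 = 1/4 - alpha_sharp \<nu>"
  using alpha_sharp_bounds[OF \<nu>] by (auto simp: h_opt_def)

lemma h_opt_branches:
  assumes \<nu>: "0 < \<nu>" "\<nu> < 2"
  shows "h_opt \<nu> = (if \<nu> \<le> (sqrt 17 - 1) / 4
                then sqrt (1/4 - alpha_rep \<nu>)
                else sqrt (1/4 - 2 * (\<nu> - 2) / (\<nu> + 2)))"
  using alpha_sing_le_rep_iff[OF \<nu>]
  by (auto simp: h_opt_def alpha_sharp_def max_def alpha_sing_def)

lemma h_opt_three_halves: "h_opt (3/2) = sqrt (15/28)"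
  using nu0_bounds by (subst h_opt_branches) auto

lemma h_opt_half: "\<bar>h_opt (1/2) - 1.065615\<bar> < 0.0000005"
proof -
  let ?\<alpha> = "alpha_rep (1/2)"
  have h: "h_opt (1/2) = sqrt (1/4 - ?\<alpha>)"
    using nu0_bounds by (subst h_opt_branches) auto
  \<comment> \<open>The values \<alpha> = 1/4 - h^2 at the two ends of the rounding interval;
    opposite signs of the quartic enclose the root.\<close>
  define l u :: real where "l = 1/4 - 1.0656155\<^sup>2" and "u = 1/4 - 1.0656145\<^sup>2"
  have "rep_poly (1/2) u > 0" "rep_poly (1/2) l < 0" and lu: "-1 < l" "-1 < u" "l < 1/4" "u < 1/4"
    by (simp_all add: rep_poly_def l_def u_def power2_eq_square power3_eq_cube power4_eq_xxxx)
  moreover have "u > ?\<alpha>"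
  proof (rule ccontr)
    assume "\<not> u > ?\<alpha>"
    then show False
      using rep_poly_neg[of "1/2" u] rep_poly_alpha_rep[of "1/2"] \<open>rep_poly (1/2) u > 0\<close> lu
      by (cases "u = ?\<alpha>") auto
  qed
  moreover have "l < ?\<alpha>"
  proof (rule ccontr)
    assume "\<not> l < ?\<alpha>"
    then show False
      using rep_poly_pos[of "1/2" l] rep_poly_alpha_rep[of "1/2"] \<open>rep_poly (1/2) l < 0\<close> lu
      by (cases "l = ?\<alpha>") auto
  qed
  ultimately have sq: "1.0656145\<^sup>2 < 1/4 - ?\<alpha>" "1/4 - ?\<alpha> < 1.0656155\<^sup>2"
    by (simp_all add: l_def u_def)
  have "1.0656145 < h_opt (1/2)" unfolding h by (rule real_less_rsqrt[OF sq(1)])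
  moreover have "h_opt (1/2) < 1.0656155" unfolding h by (rule real_less_lsqrt[OF _ sq(2)]) simp
  ultimately show ?thesis by (simp add: abs_if)
qed

section \<open>Multiplicativity of the ratio inequalities\<close>

text \<open>
  A pair \<open>(a, b)\<close> records the ratios \<open>F(1/2)/F(3/2)\<close> and \<open>F(5/2)/F(3/2)\<close>. A real zero \<open>u\<close> of \<open>F\<close>, with
  \<open>\<alpha> = 1/4 - u\<^sup>2\<close>, contributes \<open>(x, 3 - 2x)\<close> where \<open>x = \<alpha>/(\<alpha> + 2)\<close>. The condition
  \<open>b * ratio_quad \<nu> a \<le> (1 + \<nu>) * a\<close> says that the pencil \<open>M(y\<^sup>2) + t M(y)\<close> is nonpositive at the zero
  of \<open>M(y)\<close>, that is, real-rooted for all \<open>t\<close>.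
\<close>
definition ratio_quad :: "real \<Rightarrow> real \<Rightarrow> real" where
  "ratio_quad \<nu> a = 3 * \<nu> * a\<^sup>2 + 3 * (1 - \<nu>) * a - (2 - \<nu>)"

text \<open>The lower bound on \<open>b\<close> is an equality for a single real zero and forces b
  \<ge> 1. An upper bound on \<open>b\<close> is imposed only where \<open>ratio_quad\<close> is
  positive.\<close>

definition pos_class :: "real \<Rightarrow> (real \<times> real) set" where
  "pos_class \<nu> = {(a, b). 0 \<le> a \<and> a \<le> 1 \<and> 3 - 2 * a \<le> b \<and> b * ratio_quad \<nu> a \<le> (1 + \<nu>) * a}"

definition x_sharp :: "real \<Rightarrow> real" where
  "x_sharp \<nu> = alpha_sharp \<nu> / (alpha_sharp \<nu> + 2)"

text \<open>The one unpaired negative zero stays an explicit factor with exact second coordinate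
  \<open>3 - 2 * x\<close>; this supplies the upper bound needed when two such elements are
  multiplied.\<close>

definition neg_class :: "real \<Rightarrow> (real \<times> real) set" where
  "neg_class \<nu> = {(x * a, (3 - 2 * x) * b) | x a b. x_sharp \<nu> \<le> x \<and> x < 0 \<and> (a, b) \<in> pos_class \<nu>}"

text \<open>The defect for equalities is 6 (1 - x) (1 - y). Negative x and y are allowed, as pairs
  of negative factors require.\<close>

lemma factor_bound_mult:
  fixes x y :: real
  assumes "x \<le> 1" "y \<le> 1" "3 - 2 * x \<le> b" "3 - 2 * y \<le> c"
  shows "3 - 2 * (x * y) \<le> b * c"
proof -
  have "(1 - x) * (1 - y) \<ge> 0" using assms by simp
  then have "3 - 2 * (x * y) \<le> (3 - 2 * x) * (3 - 2 * y)" by (simp add: algebra_simps)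
  also have "\<dots> \<le> b * c" using assms by (intro mult_mono) auto
  finally show ?thesis .
qed

text \<open>Since \<open>ratio_quad \<nu> 1 = 1 + \<nu>\<close>, this is submultiplicativity of the
  normalized quadratic. Equality at x = 1 and at y = 1 explains the factor (1 - x) (1 - y).\<close>

lemma ratio_quad_mult:
  assumes \<nu>: "0 < \<nu>" "\<nu> < 2" and x: "0 \<le> x" "x \<le> 1" and y: "0 \<le> y" "y \<le> 1"
  shows "(1 + \<nu>) * ratio_quad \<nu> (x * y) \<le> ratio_quad \<nu> x * ratio_quad \<nu> y"
proof -
  have "ratio_quad \<nu> x * ratio_quad \<nu> y - (1 + \<nu>) * ratio_quad \<nu> (x * y)
      = (1 - x) * (1 - y) * (3 * (2 - \<nu>) + 3 * \<nu> * (2 - \<nu>) * (x * (1 - y) + y) + 3 * \<nu> * (1 + \<nu>) * (x * y))"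
    by (simp add: ratio_quad_def algebra_simps power2_eq_square)
  also have "\<dots> \<ge> 0"
    using assms by (intro mult_nonneg_nonneg add_nonneg_nonneg) auto
  finally show ?thesis by simp
qed

text \<open>Division-free form of the fact that \<open>ratio_quad \<nu> t / t\<close> increases for
  t > 0.\<close>

lemma ratio_quad_mono:
  assumes \<nu>: "0 < \<nu>" "\<nu> < 2" and "0 \<le> m" "m \<le> n"
  shows "ratio_quad \<nu> m * n \<le> ratio_quad \<nu> n * m"
proof -
  have "ratio_quad \<nu> n * m - ratio_quad \<nu> m * n = (n - m) * (3 * \<nu> * m * n + (2 - \<nu>))"
    by (simp add: ratio_quad_def algebra_simps power2_eq_square)
  also have "\<dots> \<ge> 0" using assms by simp
  finally show ?thesis by simp
qed

lemma ratio_quad_pos: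
  assumes \<nu>: "0 < \<nu>" "\<nu> < 2" and "0 \<le> m" "m \<le> n" "ratio_quad \<nu> m > 0"
  shows "ratio_quad \<nu> n > 0"
proof -
  have "m \<noteq> 0" using assms by (auto simp: ratio_quad_def)
  with assms have "m > 0" "n > 0" by auto
  then have "ratio_quad \<nu> m * n > 0" using assms by simp
  then have "ratio_quad \<nu> n * m > 0" using ratio_quad_mono[OF assms(1-4)] by linarith
  with \<open>m > 0\<close> show ?thesis by (simp add: zero_less_mult_iff)
qed

section \<open>Closure of the classes under products\<close>

lemma pos_class_one: "0 < \<nu> \<Longrightarrow> (1, 1) \<in> pos_class \<nu>"
  by (simp add: pos_class_def ratio_quad_def)

text \<open>If \<open>ratio_quad\<close> is positive at a * c, it is positive at the larger
  arguments a and c, so both upper bounds are available and multiply; otherwise the claim is a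
  matter of signs.\<close>

lemma pos_class_mult:
  assumes \<nu>: "0 < \<nu>" "\<nu> < 2" and 1: "(a, b) \<in> pos_class \<nu>" and 2: "(c, d) \<in> pos_class \<nu>"
  shows "(a * c, b * d) \<in> pos_class \<nu>"
proof -
  from 1 2 have *: "0 \<le> a" "a \<le> 1" "3 - 2 * a \<le> b" "b * ratio_quad \<nu> a \<le> (1 + \<nu>) * a"
    "0 \<le> c" "c \<le> 1" "3 - 2 * c \<le> d" "d * ratio_quad \<nu> c \<le> (1 + \<nu>) * c"
    by (auto simp: pos_class_def)
  then have bd: "b > 0" "d > 0" by auto
  have "b * d * ratio_quad \<nu> (a * c) \<le> (1 + \<nu>) * (a * c)"
  proof (cases "ratio_quad \<nu> (a * c) > 0")
    case False
    then have "b * d * ratio_quad \<nu> (a * c) \<le> 0" using bd by (intro mult_nonneg_nonpos) auto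
    also have "0 \<le> (1 + \<nu>) * (a * c)" using * \<nu> by simp
    finally show ?thesis .
  next
    case True
    have "a * c \<le> a" "a * c \<le> c"
      using * by (auto intro: mult_left_le mult_left_le_one_le)
    then have qq: "ratio_quad \<nu> a > 0" "ratio_quad \<nu> c > 0"
      using ratio_quad_pos[OF \<nu> _ _ True] * by auto
    have "(1 + \<nu>) * (b * d * ratio_quad \<nu> (a * c)) = b * d * ((1 + \<nu>) * ratio_quad \<nu> (a * c))"
      by (simp add: mult_ac)
    also have "\<dots> \<le> b * d * (ratio_quad \<nu> a * ratio_quad \<nu> c)"
      using bd * ratio_quad_mult[OF \<nu>] by (intro mult_left_mono) auto
    also have "\<dots> = (b * ratio_quad \<nu> a) * (d * ratio_quad \<nu> c)" by simp
    also have "\<dots> \<le> ((1 + \<nu>) * a) * ((1 + \<nu>) * c)"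
      using * bd qq \<nu> by (intro mult_mono[of "b * ratio_quad \<nu> a" _ "d * ratio_quad \<nu> c"]) auto
    finally have "(1 + \<nu>) * (b * d * ratio_quad \<nu> (a * c)) \<le> (1 + \<nu>) * ((1 + \<nu>) * (a * c))"
      by (simp add: mult_ac)
    then show ?thesis using \<nu> by (simp add: mult_le_cancel_left)
  qed
  then show ?thesis
    using * factor_bound_mult[of a c b d] by (simp add: pos_class_def mult_le_one)
qed

text \<open>Origin of \<open>alpha_sing\<close>: for a = \<alpha> / (\<alpha> + 2) the linear factor
  vanishes exactly at \<alpha> = \<open>alpha_sing \<nu>\<close>.\<close>

lemma single_residual:
  "(1 + \<nu>) * a - (3 - 2 * a) * ratio_quad \<nu> a = 3 * (1 - a)\<^sup>2 * (2 - \<nu> + 2 * \<nu> * a)"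
  by (simp add: ratio_quad_def algebra_simps power2_eq_square)

lemma pos_class_single:
  assumes "0 < \<nu>" "\<nu> < 2" "0 \<le> x" "x \<le> 1"
  shows "(x, 3 - 2 * x) \<in> pos_class \<nu>"
proof -
  have "3 * (1 - x)\<^sup>2 * (2 - \<nu> + 2 * \<nu> * x) \<ge> 0" using assms by simp
  then have "(3 - 2 * x) * ratio_quad \<nu> x \<le> (1 + \<nu>) * x" using single_residual[of \<nu> x] by linarith
  then show ?thesis using assms by (simp add: pos_class_def)
qed

lemma x_sharp_bounds:
  assumes \<nu>: "0 < \<nu>" "\<nu> < 2"
  shows "-1 < x_sharp \<nu>" "x_sharp \<nu> < 0" "2 - \<nu> + 2 * \<nu> * x_sharp \<nu> \<ge> 0"
proof -
  note s = alpha_sharp_bounds[OF \<nu>]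
  show "-1 < x_sharp \<nu>" "x_sharp \<nu> < 0"
    using s by (auto simp: x_sharp_def field_simps)
  have "alpha_sing \<nu> \<le> alpha_sharp \<nu>" by (simp add: alpha_sharp_def)
  then have "2 * (\<nu> - 2) \<le> alpha_sharp \<nu> * (\<nu> + 2)"
    using \<nu> by (simp add: alpha_sing_def field_simps)
  then show "2 - \<nu> + 2 * \<nu> * x_sharp \<nu> \<ge> 0"
    using s by (simp add: x_sharp_def field_simps)
qed

text \<open>For a double real zero the defect of the inequality is, up to a positive factor, the
  quartic defining the threshold.\<close>
lemma double_residual:
  assumes "\<alpha> > -2" and x: "x = \<alpha> / (\<alpha> + 2)"
  shows "((1 + \<nu>) * x\<^sup>2 - (3 - 2 * x)\<^sup>2 * ratio_quad \<nu> (x\<^sup>2)) * (\<alpha> + 2) ^ 6 = 24 * rep_poly \<nu> \<alpha>"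
proof -
  define e where "e = \<alpha> + 2"
  have xe: "x * e = \<alpha>" and e: "\<alpha> = e - 2" using assms by (auto simp: e_def)
  have "((1 + \<nu>) * x\<^sup>2 - (3 - 2 * x)\<^sup>2 * ratio_quad \<nu> (x\<^sup>2)) * e ^ 6
     = (1 + \<nu>) * (x * e)\<^sup>2 * e ^ 4 - (3 * e - 2 * (x * e))\<^sup>2
         * (3 * \<nu> * (x * e) ^ 4 + 3 * (1 - \<nu>) * (x * e)\<^sup>2 * e\<^sup>2 - (2 - \<nu>) * e ^ 4)"
    by (simp add: ratio_quad_def algebra_simps power2_eq_square power4_eq_xxxx eval_nat_numeral)
  also have "\<dots> = 24 * rep_poly \<nu> \<alpha>"
    unfolding xe unfolding e
    by (simp add: rep_poly_def algebra_simps power2_eq_square power4_eq_xxxx power3_eq_cube)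
  finally show ?thesis by (simp add: e_def)
qed

text \<open>With both factors negative, the inequality becomes harder as either moves away from \<open>0\<close>,
  so the diagonal point at the threshold is the worst case.\<close>
lemma neg_pair:
  assumes \<nu>: "0 < \<nu>" "\<nu> < 2" and x: "x_sharp \<nu> \<le> x" "x < 0" and y: "x_sharp \<nu> \<le> y" "y < 0"
  shows "(x * y, (3 - 2 * x) * (3 - 2 * y)) \<in> pos_class \<nu>"
proof -
  define s where "s = x_sharp \<nu>"
  note s = x_sharp_bounds[OF \<nu>, folded s_def] and x = x[folded s_def] and y = y[folded s_def]
  have sq: "(3 - 2 * s)\<^sup>2 * ratio_quad \<nu> (s\<^sup>2) \<le> (1 + \<nu>) * s\<^sup>2"
  proof -
    have "rep_poly \<nu> (alpha_sharp \<nu>) \<ge> 0"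
      using alpha_sharp_bounds[OF \<nu>] by (intro rep_poly_nonneg_sharp[OF \<nu>]) auto
    with double_residual[of "alpha_sharp \<nu>" s \<nu>] alpha_sharp_bounds[OF \<nu>]
    have "0 \<le> ((1 + \<nu>) * s\<^sup>2 - (3 - 2 * s)\<^sup>2 * ratio_quad \<nu> (s\<^sup>2)) * (alpha_sharp \<nu> + 2) ^ 6"
      by (simp add: s_def x_sharp_def)
    with alpha_sharp_bounds[OF \<nu>] show ?thesis by (simp add: zero_le_mult_iff)
  qed
  have xy: "0 < x * y" "x * y \<le> s\<^sup>2"
  proof -
    show "0 < x * y" using x y by (simp add: mult_neg_neg)
    have "(-x) * (-y) \<le> (-s) * (-s)" using x y s by (intro mult_mono) auto
    then show "x * y \<le> s\<^sup>2" by (simp add: power2_eq_square)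
  qed
  have s1: "s\<^sup>2 \<le> 1" using s by (auto simp: abs_square_le_1)
  have "(3 - 2 * x) * (3 - 2 * y) * ratio_quad \<nu> (x * y) \<le> (1 + \<nu>) * (x * y)"
  proof (cases "ratio_quad \<nu> (x * y) > 0")
    case False
    then have "(3 - 2 * x) * (3 - 2 * y) * ratio_quad \<nu> (x * y) \<le> 0"
      using x y by (intro mult_nonneg_nonpos) auto
    also have "0 \<le> (1 + \<nu>) * (x * y)" using xy \<nu> by simp
    finally show ?thesis .
  next
    case True
    \<comment> \<open>The factor s^2 avoids a quotient: the linear factors are moved to
      \<open>s\<close> first, then \<open>ratio_quad_mono\<close> trades the argument x * y for
      s^2.\<close>
    have "(3 - 2 * x) * (3 - 2 * y) * ratio_quad \<nu> (x * y) * s\<^sup>2 \<le> (3 - 2 * s) * (3 - 2 * s) * ratio_quad \<nu> (x * y) * s\<^sup>2"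
      using x y s True by (intro mult_right_mono mult_mono) auto
    also have "\<dots> \<le> (3 - 2 * s)\<^sup>2 * (ratio_quad \<nu> (s\<^sup>2) * (x * y))"
      using ratio_quad_mono[OF \<nu>, of "x * y" "s\<^sup>2"] xy mult_left_mono[of _ _ "(3 - 2 * s)\<^sup>2"]
      by (simp add: power2_eq_square mult.assoc)
    also have "\<dots> \<le> ((1 + \<nu>) * s\<^sup>2) * (x * y)"
      using mult_right_mono[OF sq, of "x * y"] xy by (simp add: mult_ac)
    finally have "((3 - 2 * x) * (3 - 2 * y) * ratio_quad \<nu> (x * y)) * s\<^sup>2 \<le> ((1 + \<nu>) * (x * y)) * s\<^sup>2"
      by (simp add: mult_ac)
    then show ?thesis using s(2) by (simp add: mult_le_cancel_right)
  qed
  then show ?thesis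
    using xy s1 factor_bound_mult[of x y "3 - 2 * x" "3 - 2 * y"] x y by (simp add: pos_class_def)
qed

lemma class_mult:
  assumes \<nu>: "0 < \<nu>" "\<nu> < 2"
    and 1: "(a, b) \<in> pos_class \<nu> \<union> neg_class \<nu>" and 2: "(c, d) \<in> pos_class \<nu> \<union> neg_class \<nu>"
  shows "(a * c, b * d) \<in> pos_class \<nu> \<union> neg_class \<nu>"
proof -
  have pn: "(a * c, b * d) \<in> neg_class \<nu>"
    if "(a, b) \<in> pos_class \<nu>" "(c, d) \<in> neg_class \<nu>" for a b c d
  proof -
    from that(2) obtain x c' d' where x: "c = x * c'" "d = (3 - 2 * x) * d'" "x_sharp \<nu> \<le> x" "x < 0"
      "(c', d') \<in> pos_class \<nu>" by (auto simp: neg_class_def)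
    have "(a * c, b * d) = (x * (a * c'), (3 - 2 * x) * (b * d'))" using x by simp
    then show ?thesis unfolding neg_class_def
      using x pos_class_mult[OF \<nu> that(1) x(5)] by blast
  qed
  have nn: "(a * c, b * d) \<in> pos_class \<nu>"
    if 1: "(a, b) \<in> neg_class \<nu>" and 2: "(c, d) \<in> neg_class \<nu>" for a b c d
  proof -
    from 1 obtain x a' b' where x: "a = x * a'" "b = (3 - 2 * x) * b'" "x_sharp \<nu> \<le> x" "x < 0"
      "(a', b') \<in> pos_class \<nu>" by (auto simp: neg_class_def)
    from 2 obtain y c' d' where y: "c = y * c'" "d = (3 - 2 * y) * d'" "x_sharp \<nu> \<le> y" "y < 0"
      "(c', d') \<in> pos_class \<nu>" by (auto simp: neg_class_def)
    have "((x * y) * (a' * c'), ((3 - 2 * x) * (3 - 2 * y)) * (b' * d')) \<in> pos_class \<nu>"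
      by (intro pos_class_mult neg_pair \<nu> x y)
    moreover have "((x * y) * (a' * c'), ((3 - 2 * x) * (3 - 2 * y)) * (b' * d')) = (a * c, b * d)"
      using x y by simp
    ultimately show ?thesis by simp
  qed
  show ?thesis
    using 1 2 pn[of a b c d] pn[of c d a b] nn[of a b c d] pos_class_mult[OF \<nu>, of a b c d]
    by (auto simp: mult.commute)
qed

text \<open>Here \<open>w\<close> is the real square of a zero of F, so that purely imaginary zeros
  are included as w < 0. The map \<alpha> / (\<alpha> + 2) = 1 - 2 / (\<alpha> + 2) is increasing,
  which transfers the threshold to \<open>x_sharp\<close>.\<close>

lemma class_real_factor:
  assumes \<nu>: "0 < \<nu>" "\<nu> < 2" and w: "w \<le> (h_opt \<nu>)\<^sup>2"
  defines "x \<equiv> (1/4 - w) / (9/4 - w)"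
  shows "(x, (25/4 - w) / (9/4 - w)) \<in> pos_class \<nu> \<union> neg_class \<nu>"
proof -
  define \<alpha> where "\<alpha> = 1/4 - w"
  have \<alpha>: "alpha_sharp \<nu> \<le> \<alpha>" "\<alpha> > -1"
    using w alpha_sharp_bounds[OF \<nu>] by (auto simp: h_opt_sq[OF \<nu>] \<alpha>_def)
  have x: "x = \<alpha> / (\<alpha> + 2)" by (simp add: x_def \<alpha>_def)
  have b: "(25/4 - w) / (9/4 - w) = 3 - 2 * x" using \<alpha>(2) by (simp add: x_def \<alpha>_def field_simps)
  show ?thesis
  proof (cases "x \<ge> 0")
    case True
    have "x \<le> 1" using \<alpha> by (simp add: x)
    then show ?thesis unfolding b using pos_class_single[OF \<nu> True] by simp
  next
    case False
    have "x = 1 - 2 / (\<alpha> + 2)" "x_sharp \<nu> = 1 - 2 / (alpha_sharp \<nu> + 2)"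
      using \<alpha> alpha_sharp_bounds[OF \<nu>] by (simp_all add: x x_sharp_def field_simps)
    moreover have "2 / (\<alpha> + 2) \<le> 2 / (alpha_sharp \<nu> + 2)"
      using \<alpha> alpha_sharp_bounds[OF \<nu>] by (intro divide_left_mono) auto
    ultimately have "x_sharp \<nu> \<le> x" by linarith
    with False have "(x * 1, (3 - 2 * x) * 1) \<in> neg_class \<nu>"
      unfolding neg_class_def mem_Collect_eq not_le using pos_class_one[OF \<nu>(1)] by blast
    then show ?thesis unfolding b by simp
  qed
qed

text \<open>\<open>S = (Re u)\<^sup>2\<close> and \<open>T = (Im u)\<^sup>2\<close> for a zero \<open>u\<close>; with \<open>\<alpha> = 1/4 - S\<close> the defect of the inequality
  is a polynomial in \<open>T\<close> with nonnegative coefficients.\<close>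
lemma class_complex_factor:
  assumes \<nu>: "0 < \<nu>" "\<nu> < 2" and S: "0 \<le> S" "S \<le> (h_opt \<nu>)\<^sup>2" and T: "0 \<le> T"
  defines "N \<equiv> \<lambda>c. (c - S)\<^sup>2 + 2 * T * (c + S) + T\<^sup>2"
  shows "(N (1/4) / N (9/4), N (25/4) / N (9/4)) \<in> pos_class \<nu>"
proof -
  define \<alpha> where "\<alpha> = 1/4 - S"
  have \<alpha>: "alpha_sharp \<nu> \<le> \<alpha>" "-91/100 < \<alpha>" "\<alpha> \<le> 1/4"
    using S alpha_sharp_bounds[OF \<nu>] by (auto simp: h_opt_sq[OF \<nu>] \<alpha>_def)
  \<comment> \<open>\<open>N c\<close> is |u^2 - c|^2. At T = 0 these are squares, the data of a
    double real zero, so the constant term of the expansion in T below is the quartic.\<close>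
  have N1: "N (1/4) = \<alpha>\<^sup>2 + T * (1 - 2 * \<alpha>) + T\<^sup>2"
    and N9: "N (9/4) = (\<alpha> + 2)\<^sup>2 + T * (5 - 2 * \<alpha>) + T\<^sup>2"
    and N25: "N (25/4) = (\<alpha> + 6)\<^sup>2 + T * (13 - 2 * \<alpha>) + T\<^sup>2"
    by (auto simp: N_def \<alpha>_def algebra_simps power2_eq_square)
  have pos: "N (9/4) > 0" unfolding N9 using \<alpha> T by (intro add_pos_nonneg) auto
  have n1: "N (1/4) \<ge> 0" unfolding N1 using \<alpha> T by simp
  have le: "N (1/4) \<le> N (9/4)"
  proof -
    have "N (9/4) - N (1/4) = 4 * (\<alpha> + 1) + 4 * T"
      unfolding N1 N9 by (simp add: algebra_simps power2_eq_square)
    then show ?thesis using \<alpha> T by simp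
  qed
  have b: "3 * N (9/4) - 2 * N (1/4) \<le> N (25/4)"
    unfolding N1 N9 N25 by (simp add: algebra_simps power2_eq_square)
  define c1 where "c1 = 48 * (2 * (1 + \<nu>) * \<alpha> ^ 3 + (19 - 16 * \<nu>) * \<alpha>\<^sup>2 + (78 - 42 * \<nu>) * \<alpha> + (60 - 25 * \<nu>))"
  define c2 where "c2 = 24 * (99 - 27 * \<nu> + (48 - 24 * \<nu>) * \<alpha> - (14 + 10 * \<nu>) * \<alpha>\<^sup>2)"
  define c3 where "c3 = 96 * ((1 + \<nu>) * \<alpha>) + 720"
  have E: "(1 + \<nu>) * N (1/4) * (N (9/4))\<^sup>2 - N (25/4) * (3 * \<nu> * (N (1/4))\<^sup>2
        + 3 * (1 - \<nu>) * N (1/4) * N (9/4) - (2 - \<nu>) * (N (9/4))\<^sup>2)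
      = 24 * rep_poly \<nu> \<alpha> + c1 * T + c2 * T\<^sup>2 + c3 * T ^ 3 + 24 * (\<nu> + 3) * T ^ 4"
    unfolding N1 N9 N25
    by (simp add: c1_def c2_def c3_def rep_poly_def algebra_simps power2_eq_square power3_eq_cube power4_eq_xxxx)
  have "c1 \<ge> 0"
  proof -
    \<comment> \<open>Values of \<open>c1 / 48\<close> at \<nu> = 0 and \<nu> = 2. Each is divided
      by \<alpha> + 91/100; quotient and remainder are nonnegative in the admissible range.\<close>
    define p r where "p = 2 * \<alpha> ^ 3 + 19 * \<alpha>\<^sup>2 + 78 * \<alpha> + 60"
      and "r = 6 * \<alpha> ^ 3 - 13 * \<alpha>\<^sup>2 - 6 * \<alpha> + 10"
    have "c1 = 48 * ((1 - \<nu> / 2) * p + \<nu> / 2 * r)"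
      by (simp add: c1_def p_def r_def algebra_simps)
    moreover have "p = (\<alpha> + 91/100) * (2 * \<alpha>\<^sup>2 + (859/50 * \<alpha> + 311831/5000)) + 1623379/500000"
      by (simp add: p_def field_simps power2_eq_square power3_eq_cube)
    moreover have "(\<alpha> + 91/100) * (2 * \<alpha>\<^sup>2 + (859/50 * \<alpha> + 311831/5000)) \<ge> 0"
      using \<alpha> by (intro mult_nonneg_nonneg[OF _ add_nonneg_nonneg]) auto
    moreover have "r = (\<alpha> + 91/100) * (6 * \<alpha>\<^sup>2 + (53993/5000 - 923/50 * \<alpha>)) + 86637/500000"
      by (simp add: r_def field_simps power2_eq_square power3_eq_cube)
    moreover have "(\<alpha> + 91/100) * (6 * \<alpha>\<^sup>2 + (53993/5000 - 923/50 * \<alpha>)) \<ge> 0"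
      using \<alpha> by (intro mult_nonneg_nonneg[OF _ add_nonneg_nonneg]) auto
    ultimately show ?thesis using \<nu> \<alpha> by simp
  qed
  moreover have "c2 \<ge> 0"
  proof -
    have "\<alpha>\<^sup>2 \<le> 1" using \<alpha> by (auto simp: abs_square_le_1)
    then have "(14 + 10 * \<nu>) * \<alpha>\<^sup>2 \<le> 14 + 10 * \<nu>" using \<nu> by (simp add: mult_left_le)
    moreover have "(48 - 24 * \<nu>) * \<alpha> \<ge> 546/25 * \<nu> - 1092/25"
      using mult_left_mono[of "-91/100" \<alpha> "48 - 24 * \<nu>"] \<nu> \<alpha>
      by (simp add: field_simps)
    ultimately have "99 - 27 * \<nu> + (48 - 24 * \<nu>) * \<alpha> - (14 + 10 * \<nu>) * \<alpha>\<^sup>2 \<ge> 0"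
      using \<nu> by linarith
    then show ?thesis by (simp add: c2_def)
  qed
  moreover have "c3 \<ge> 0"
  proof -
    have "(1 + \<nu>) * \<alpha> \<ge> (1 + \<nu>) * (-1)" using \<nu> \<alpha> by (intro mult_left_mono) auto
    then show ?thesis using \<nu> by (simp add: c3_def)
  qed
  moreover have "rep_poly \<nu> \<alpha> \<ge> 0" by (rule rep_poly_nonneg_sharp[OF \<nu> \<alpha>(1,3)])
  ultimately have "(1 + \<nu>) * N (1/4) * (N (9/4))\<^sup>2 - N (25/4) * (3 * \<nu> * (N (1/4))\<^sup>2
        + 3 * (1 - \<nu>) * N (1/4) * N (9/4) - (2 - \<nu>) * (N (9/4))\<^sup>2) \<ge> 0"
    unfolding E using T \<nu> by simp
  moreover define D where "D = (1 + \<nu>) * (N (1/4) / N (9/4)) - N (25/4) / N (9/4) * ratio_quad \<nu> (N (1/4) / N (9/4))"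
  have "D * N (9/4) ^ 3 = (1 + \<nu>) * N (1/4) * (N (9/4))\<^sup>2 - N (25/4) * (3 * \<nu> * (N (1/4))\<^sup>2
        + 3 * (1 - \<nu>) * N (1/4) * N (9/4) - (2 - \<nu>) * (N (9/4))\<^sup>2)"
    using pos unfolding ratio_quad_def D_def by (simp add: field_simps power2_eq_square power3_eq_cube)
  ultimately have "0 \<le> D * N (9/4) ^ 3" by simp
  then have "0 \<le> D" using pos by (simp add: zero_le_mult_iff)
  then have "N (25/4) / N (9/4) * ratio_quad \<nu> (N (1/4) / N (9/4)) \<le> (1 + \<nu>) * (N (1/4) / N (9/4))"
    unfolding D_def by (rule diff_ge_0_iff_ge[THEN iffD1])
  moreover have "3 - 2 * (N (1/4) / N (9/4)) \<le> N (25/4) / N (9/4)"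
    using divide_right_mono[OF b, of "N (9/4)"] pos by (simp add: diff_divide_distrib)
  ultimately show ?thesis
    using pos n1 le by (simp add: pos_class_def)
qed

text \<open>These are the closed conditions that are passed to the limit. For a \<le> 0 the
  quadratic is nonpositive, so enlarging \<open>b\<close> only helps and the smallest value 3 - 2 a
  reduces to \<open>single_residual\<close>.\<close>

lemma class_bounds:
  assumes \<nu>: "0 < \<nu>" "\<nu> < 2" and ab: "(a, b) \<in> pos_class \<nu> \<union> neg_class \<nu>"
  shows "x_sharp \<nu> \<le> a" "a \<le> 1" "1 \<le> b" "b * ratio_quad \<nu> a \<le> (1 + \<nu>) * a"
proof -
  have "x_sharp \<nu> \<le> a \<and> a \<le> 1 \<and> 1 \<le> b \<and> b * ratio_quad \<nu> a \<le> (1 + \<nu>) * a"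
  proof (cases "(a, b) \<in> pos_class \<nu>")
    case True
    then show ?thesis using x_sharp_bounds[OF \<nu>] by (auto simp: pos_class_def)
  next
    case False
    with ab obtain x c d where x: "a = x * c" "b = (3 - 2 * x) * d" "x_sharp \<nu> \<le> x" "x < 0"
      and c: "0 \<le> c" "c \<le> 1" "3 - 2 * c \<le> d" by (auto simp: neg_class_def pos_class_def)
    have a: "x \<le> a" "a \<le> 0"
      using x c mult_left_mono_neg[of c 1 x] by (auto simp: mult_le_0_iff)
    have b: "3 - 2 * a \<le> b" unfolding x using x c by (intro factor_bound_mult) auto
    have "2 - \<nu> + 2 * \<nu> * a \<ge> 2 - \<nu> + 2 * \<nu> * x_sharp \<nu>"
      using order_trans[OF x(3) a(1)] \<nu> by simp
    then have r: "2 - \<nu> + 2 * \<nu> * a \<ge> 0" using x_sharp_bounds[OF \<nu>] by linarith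
    have "ratio_quad \<nu> a \<le> 0"
    proof -
      have "2 * ratio_quad \<nu> a = 3 * a * (2 - \<nu> + 2 * \<nu> * a) - 3/2 * (2 - \<nu> + 2 * \<nu> * a) - (2 - \<nu>) / 2"
        by (simp add: ratio_quad_def field_simps power2_eq_square)
      moreover have "3 * a * (2 - \<nu> + 2 * \<nu> * a) \<le> 0"
        using a mult_nonpos_nonneg[OF _ r, of "3 * a"] by simp
      ultimately show ?thesis using r \<nu>(2) by argo
    qed
    then have "b * ratio_quad \<nu> a \<le> (3 - 2 * a) * ratio_quad \<nu> a" using b by (intro mult_right_mono_neg)
    also have "\<dots> \<le> (1 + \<nu>) * a"
    proof -
      have "0 \<le> 3 * (1 - a)\<^sup>2 * (2 - \<nu> + 2 * \<nu> * a)" using r by simp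
      then show ?thesis using single_residual[of \<nu> a] by linarith
    qed
    finally show ?thesis using a b x(3) by linarith
  qed
  then show "x_sharp \<nu> \<le> a" "a \<le> 1" "1 \<le> b" "b * ratio_quad \<nu> a \<le> (1 + \<nu>) * a" by auto
qed

section \<open>Entire functions of small growth as limits of products over their zeros\<close>

text \<open>A zero may be used any number of times: class membership depends only on where zeros
  lie. Nonreal zeros enter with their conjugates, which keeps every product real on the real
  line.\<close>

inductive zero_product :: "complex set \<Rightarrow> (complex \<Rightarrow> complex) \<Rightarrow> bool" for Z where
  one: "zero_product Z (\<lambda>_. 1)"
| real_zero: "zero_product Z p \<Longrightarrow> a \<in> Z \<Longrightarrow> a \<in> \<real> \<Longrightarrow> a \<noteq> 0 \<Longrightarrow> zero_product Z (\<lambda>z. p z * (1 - z / a))"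
| conj_zeros: "zero_product Z p \<Longrightarrow> a \<in> Z \<Longrightarrow> a \<notin> \<real> \<Longrightarrow>
    zero_product Z (\<lambda>z. p z * ((1 - z / a) * (1 - z / cnj a)))"

lemma zero_product_0: "zero_product Z p \<Longrightarrow> p 0 = 1"
  by (induction rule: zero_product.induct) auto

lemma factor_entire:
  assumes h: "h holomorphic_on UNIV" and a: "h a = 0" "a \<noteq> 0"
  obtains k where "k holomorphic_on UNIV" "\<And>z. h z = (1 - z / a) * k z"
proof
  define k where "k = (\<lambda>z. if z = a then deriv h a else h z / (z - a))"
  have "k holomorphic_on UNIV"
    by (rule pole_theorem_open_0[OF h, of a]) (use a in \<open>auto simp: k_def\<close>)
  then show "(\<lambda>z. - a * k z) holomorphic_on UNIV" by (intro holomorphic_intros)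
  show "h z = (1 - z / a) * (- a * k z)" for z
    using a by (auto simp: k_def field_simps)
qed

text \<open>Off the finitely many zeros of \<open>p\<close> the factor cancels; continuity covers
  the rest.\<close>

lemma real_cofactor:
  assumes f: "real_function f" "real_function p" "\<And>z. f z = p z * k z"
    and k: "k holomorphic_on UNIV" and fin: "finite {z. p z = 0}"
  shows "real_function k"
proof -
  have "k (cnj z) = cnj (k z)" for z
  proof -
    define g where "g = (\<lambda>z. k z - cnj (k (cnj z)))"
    have g0: "g z = 0" if "p z \<noteq> 0" for z
      using that f unfolding g_def real_function_def
      by (metis complex_cnj_cnj complex_cnj_mult eq_iff_diff_eq_0 mult_cancel_left)
    have kc: "continuous_on UNIV k" by (intro holomorphic_on_imp_continuous_on k)
    have "continuous_on UNIV g" unfolding g_def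
      by (intro continuous_intros kc continuous_on_compose2[OF kc]) auto
    then have "(g \<longlongrightarrow> g z) (at z)" by (simp add: continuous_on_def)
    moreover have "eventually (\<lambda>w. g w = 0) (at z)"
    proof -
      have "eventually (\<lambda>w. w \<notin> {z. p z = 0}) (at z)"
        using fin by (metis islimpt_finite islimpt_iff_eventually)
      then show ?thesis by eventually_elim (use g0 in auto)
    qed
    then have "(g \<longlongrightarrow> 0) (at z)" using tendsto_eventually by blast
    ultimately have "g z = 0" by (rule LIM_unique)
    then show ?thesis by (metis g_def complex_cnj_cnj eq_iff_diff_eq_0)
  qed
  then show ?thesis by (simp add: real_function_def)
qed

lemma real_factor:
  assumes h: "h holomorphic_on UNIV" "real_function h" and a: "h a = 0" "a \<in> \<real>" "a \<noteq> 0"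
  obtains k where "k holomorphic_on UNIV" "real_function k" "\<And>z. h z = (1 - z / a) * k z"
proof -
  obtain k where k: "k holomorphic_on UNIV" "\<And>z. h z = (1 - z / a) * k z"
    using factor_entire[OF h(1) a(1,3)] by blast
  have "{z. 1 - z / a = 0} = {a}" using a by auto
  then have "real_function k"
    using a by (intro real_cofactor[OF h(2) _ k(2,1)]) (auto simp: real_function_def Reals_cnj_iff)
  then show ?thesis using k that by blast
qed

lemma conj_factor:
  assumes h: "h holomorphic_on UNIV" "real_function h" and a: "h a = 0" "a \<notin> \<real>"
  obtains k where "k holomorphic_on UNIV" "real_function k"
    "\<And>z. h z = ((1 - z / a) * (1 - z / cnj a)) * k z"
proof -
  have a0: "a \<noteq> 0" "cnj a \<noteq> 0" "cnj a \<noteq> a" using a by (auto simp: Reals_cnj_iff)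
  obtain k where k: "k holomorphic_on UNIV" "\<And>z. h z = (1 - z / a) * k z"
    using factor_entire[OF h(1) a(1) a0(1)] by blast
  have "h (cnj a) = 0" using h(2) a by (simp add: real_function_def)
  then have "k (cnj a) = 0" using k(2)[of "cnj a"] a0 by (auto simp: field_simps)
  then obtain l where l: "l holomorphic_on UNIV" "\<And>z. k z = (1 - z / cnj a) * l z"
    using factor_entire[OF k(1) _ a0(2)] by blast
  have hl: "h z = ((1 - z / a) * (1 - z / cnj a)) * l z" for z by (simp add: k l)
  have "{z. (1 - z / a) * (1 - z / cnj a) = 0} \<subseteq> {a, cnj a}" using a0 by auto
  then have "real_function l"
    by (intro real_cofactor[OF h(2) _ hl l(1)]) (auto simp: real_function_def intro: finite_subset)
  then show ?thesis using l(1) hl that by blast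
qed

text \<open>The radius 3R makes |z / a| at least 3, which leaves 2 after subtracting 1.\<close>

lemma norm_factor_ge_2:
  fixes a z :: complex
  assumes "a \<noteq> 0" "norm a \<le> R" "norm z = 3 * R"
  shows "norm (1 - z / a) \<ge> 2"
proof -
  have "norm (z / a) \<ge> 3"
    using assms by (simp add: norm_divide field_simps)
  then show ?thesis using norm_triangle_ineq3[of 1 "z / a"] by simp
qed

text \<open>Every extracted factor has modulus at least \<open>2\<close> on \<open>|z| = 3R\<close>, so the maximum modulus principle
  bounds the number of factors; a maximal factorization leaves a cofactor without zeros in
  \<open>|z| \<le> R\<close>, and multiplicities never have to be counted.\<close>
lemma extract_zeros:
  assumes f: "f holomorphic_on UNIV" "real_function f" "f 0 = 1" and R: "R > 0"
    and M: "\<And>z. norm z = 3 * R \<Longrightarrow> norm (f z) \<le> M"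
  obtains p h where "zero_product {z. f z = 0} p" "h holomorphic_on UNIV" "\<And>z. f z = p z * h z"
    "h 0 = 1" "\<And>z. norm z \<le> R \<Longrightarrow> h z \<noteq> 0" "\<And>z. norm z \<le> R \<Longrightarrow> norm (h z) \<le> M"
proof -
  define Q where "Q n p h \<longleftrightarrow> zero_product {z. f z = 0} p \<and> h holomorphic_on UNIV \<and> real_function h
     \<and> (\<forall>z. f z = p z * h z) \<and> (\<forall>z. norm z = 3 * R \<longrightarrow> 2 ^ n \<le> norm (p z))" for n :: nat and p h
  have Q0: "Q 0 (\<lambda>_. 1) f" using f by (auto simp: Q_def intro: one)
  have bd: "norm (h z) \<le> M / 2 ^ n" if Q: "Q n p h" and z: "norm z \<le> 3 * R" for n p h z
  proof (rule maximum_modulus_frontier[of h "cball 0 (3 * R)"])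
    show "h holomorphic_on interior (cball 0 (3 * R))" "continuous_on (closure (cball 0 (3 * R))) h"
      using Q by (auto simp: Q_def intro: holomorphic_on_subset holomorphic_on_imp_continuous_on)
    show "norm (h w) \<le> M / 2 ^ n" if "w \<in> frontier (cball 0 (3 * R))" for w
    proof -
      have w: "norm w = 3 * R" using that R by simp
      then have "2 ^ n * norm (h w) \<le> norm (p w) * norm (h w)"
        using Q by (intro mult_right_mono) (auto simp: Q_def)
      also have "\<dots> = norm (f w)" using Q by (simp add: Q_def norm_mult)
      finally show ?thesis using M[OF w] by (simp add: field_simps)
    qed
  qed (use z in auto)
  have h0: "h 0 = 1" if "Q n p h" for n p h
    using that f(3) zero_product_0 by (metis Q_def mult_1)
  have nM: "2 ^ n \<le> M" if "Q n p h" for n p h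
    using bd[OF that, of 0] h0[OF that] R by (simp add: field_simps)
  define S where "S = {n. \<exists>p h. Q n p h}"
  have "n \<le> nat \<lceil>M\<rceil>" if "n \<in> S" for n
  proof -
    from that obtain p h where Q: "Q n p h" by (auto simp: S_def)
    have "real n \<le> M" using nM[OF Q] of_nat_less_two_power[of n, where ?'a = real] by linarith
    then have "real n \<le> real (nat \<lceil>M\<rceil>)" using real_nat_ceiling_ge order.trans by blast
    then show ?thesis by simp
  qed
  then have "finite S" by (meson finite_nat_set_iff_bounded_le)
  moreover have "0 \<in> S" using Q0 by (auto simp: S_def)
  ultimately have mx: "Max S \<in> S" "\<And>n. n \<in> S \<Longrightarrow> n \<le> Max S"
    using Max_in by (blast, simp)
  define n where "n = Max S"
  obtain p h where Q: "Q n p h" using mx(1) by (auto simp: S_def n_def)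
  have "h a \<noteq> 0" if a: "norm a \<le> R" for a
  proof
    assume ha: "h a = 0"
    have a0: "a \<noteq> 0" using ha h0[OF Q] by auto
    have fa: "a \<in> {z. f z = 0}" using Q ha by (simp add: Q_def)
    have h: "h holomorphic_on UNIV" "real_function h" using Q by (auto simp: Q_def)
    have "\<exists>p h. Q (Suc n) p h"
    proof (cases "a \<in> \<real>")
      case True
      obtain k where k: "k holomorphic_on UNIV" "real_function k" "\<And>z. h z = (1 - z / a) * k z"
        using real_factor[OF h ha True a0] by blast
      have "2 * 2 ^ n \<le> norm (p z * (1 - z / a))" if z: "norm z = 3 * R" for z
        using mult_mono[OF norm_factor_ge_2[OF a0 a z], of "2 ^ n" "norm (p z)"] Q z
        by (simp add: Q_def norm_mult mult.commute)
      then have "Q (Suc n) (\<lambda>z. p z * (1 - z / a)) k"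
        using Q k fa True a0 by (auto simp: Q_def mult.assoc intro: real_zero)
      then show ?thesis by blast
    next
      case False
      obtain k where k: "k holomorphic_on UNIV" "real_function k"
          "\<And>z. h z = ((1 - z / a) * (1 - z / cnj a)) * k z"
        using conj_factor[OF h ha False] by blast
      have "2 * 2 ^ n \<le> norm (p z * ((1 - z / a) * (1 - z / cnj a)))" if z: "norm z = 3 * R" for z
      proof -
        \<comment> \<open>A conjugate pair counts as one extraction, so a factor 2 out of the
          available 4 suffices.\<close>
        have "2 * 1 \<le> norm (1 - z / a) * norm (1 - z / cnj a)"
          using norm_factor_ge_2[OF a0 a z] norm_factor_ge_2[of "cnj a" R z] a0 a z
          by (intro mult_mono) auto
        then have "2 ^ n * 2 \<le> norm (p z) * (norm (1 - z / a) * norm (1 - z / cnj a))"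
          using Q z by (intro mult_mono) (auto simp: Q_def)
        then show ?thesis by (simp add: norm_mult)
      qed
      then have "Q (Suc n) (\<lambda>z. p z * ((1 - z / a) * (1 - z / cnj a))) k"
        using Q k fa False by (auto simp: Q_def mult.assoc intro: conj_zeros)
      then show ?thesis by blast
    qed
    then show False using mx(2)[of "Suc n"] by (auto simp: S_def n_def)
  qed
  moreover have "norm (h z) \<le> M" if "norm z \<le> R" for z
  proof -
    have "norm (h z) \<le> M / 2 ^ n" using bd[OF Q, of z] that R by simp
    also have "\<dots> \<le> M" using nM[OF Q0] by (simp add: field_simps mult_le_cancel_left1)
    finally show ?thesis .
  qed
  ultimately show thesis using that[of p h] Q h0[OF Q] by (auto simp: Q_def)
qed

text \<open>Borel--Caratheodory: \<open>g \<mapsto> g / (2 m - g)\<close> maps the half plane \<open>Re g < m\<close>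
  into the unit disc, where the Schwarz lemma applies.\<close>
lemma borel_caratheodory_log:
  assumes h: "h holomorphic_on UNIV" "h 0 = 1" and R: "R > 0"
    and nz: "\<And>z. norm z \<le> R \<Longrightarrow> h z \<noteq> 0" and m: "\<And>z. norm z \<le> R \<Longrightarrow> norm (h z) < exp m"
    and z: "norm z < R"
  obtains w where "h z = exp w" "norm w * (1 - norm z / R) \<le> 2 * m * (norm z / R)"
proof -
  obtain g' where g': "g' holomorphic_on ball 0 R" "\<And>z. z \<in> ball 0 R \<Longrightarrow> h z = exp (g' z)"
    using contractible_imp_holomorphic_log[of h "ball 0 R"] nz h(1)
    by (metis UNIV_I convex_ball convex_imp_contractible holomorphic_on_subset less_imp_le
        mem_ball_0 subsetI)
  \<comment> \<open>Rescaled to the unit disc and shifted to vanish at 0, as the Schwarz lemma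
    demands; the shift preserves the exponential because \<open>h 0 = 1\<close>.\<close>
  define g where "g = (\<lambda>z. g' (of_real R * z) - g' 0)"
  have inb: "of_real R * z \<in> ball 0 R" if "norm z < 1" for z :: complex
    using that R by (simp add: norm_mult)
  have "(g' \<circ> (\<lambda>z. of_real R * z)) holomorphic_on ball 0 1"
    using inb by (intro holomorphic_on_compose_gen[OF _ g'(1)] holomorphic_intros) auto
  then have hg: "g holomorphic_on ball 0 1"
    unfolding g_def o_def by (intro holomorphic_intros)
  have eg: "h (of_real R * z) = exp (g z)" if "norm z < 1" for z
    using g'(2)[OF inb[OF that]] g'(2)[of 0] R h(2) by (simp add: g_def exp_diff)
  have re: "Re (g z) < m" if "norm z < 1" for z
  proof -
    have "norm (of_real R * z) \<le> R" using inb[OF that] by simp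
    from m[OF this] eg[OF that] show ?thesis by simp
  qed
  have m0: "m > 0" using re[of 0] by (simp add: g_def)
  have lt: "norm (g z) < norm (2 * of_real m - g z)" if "norm z < 1" for z
  proof -
    have "m * Re (g z) < m * m" using re[OF that] m0 by simp
    then have "(norm (g z))\<^sup>2 < (norm (2 * of_real m - g z))\<^sup>2"
      unfolding cmod_power2 by (simp add: power2_eq_square algebra_simps)
    then show ?thesis by (rule power2_less_imp_less) simp
  qed
  have ne: "2 * of_real m - g z \<noteq> 0" if "norm z < 1" for z using lt[OF that] by auto
  define \<phi> where "\<phi> = (\<lambda>z. g z / (2 * of_real m - g z))"
  have h\<phi>: "\<phi> holomorphic_on ball 0 1"
    unfolding \<phi>_def using ne by (intro holomorphic_intros hg) auto
  have \<phi>1: "norm (\<phi> z) < 1" if "norm z < 1" for z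
    using lt[OF that] ne[OF that] by (simp add: \<phi>_def norm_divide)
  have \<phi>0: "\<phi> 0 = 0" by (simp add: \<phi>_def g_def)
  define \<zeta> where "\<zeta> = z / of_real R"
  have \<zeta>: "norm \<zeta> < 1" "norm \<zeta> = norm z / R" "of_real R * \<zeta> = z"
    using z R by (auto simp: \<zeta>_def norm_divide)
  have "norm (\<phi> \<zeta>) \<le> norm \<zeta>" by (rule Schwarz_Lemma(1)[OF h\<phi> \<phi>0 \<phi>1 \<zeta>(1)])
  moreover have "g \<zeta> = \<phi> \<zeta> * (2 * of_real m - g \<zeta>)" using ne[OF \<zeta>(1)] by (simp add: \<phi>_def)
  then have "norm (g \<zeta>) = norm (\<phi> \<zeta>) * norm (2 * of_real m - g \<zeta>)" by (metis norm_mult)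
  moreover have "norm (2 * of_real m - g \<zeta>) \<le> 2 * m + norm (g \<zeta>)"
    using norm_triangle_ineq4[of "2 * of_real m" "g \<zeta>"] m0 by simp
  ultimately have "norm (g \<zeta>) \<le> norm \<zeta> * (2 * m + norm (g \<zeta>))"
    using mult_mono[of "norm (\<phi> \<zeta>)" "norm \<zeta>" "norm (2 * of_real m - g \<zeta>)" "2 * m + norm (g \<zeta>)"] by simp
  then have "norm (g \<zeta>) * (1 - norm z / R) \<le> 2 * m * (norm z / R)"
    by (simp add: \<zeta>(2)[symmetric] algebra_simps)
  moreover have "h z = exp (g \<zeta>)" using eg[OF \<zeta>(1)] \<zeta>(3) by simp
  ultimately show thesis using that by blast
qed

text \<open>Hadamard factorization below order one, without convergence of an infinite product: the
  cofactor at radius R is exp w with |w| at most about 2 B(3R) |z| / R, and this tends to 0 since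
  B(r) = o(r).\<close>

lemma zero_product_limit:
  assumes f: "f holomorphic_on UNIV" "real_function f" "f 0 = 1"
    and B: "\<And>z. norm (f z) < exp (B (norm z))" "(\<lambda>n. B (3 * real n) / real n) \<longlonglongrightarrow> 0"
  obtains P where "\<And>n. zero_product {z. f z = 0} (P n)" "\<And>z. (\<lambda>n. P n z) \<longlonglongrightarrow> f z"
proof -
  have "\<exists>p h. zero_product {z. f z = 0} p \<and> (\<forall>z. f z = p z * h z) \<and>
     (\<forall>z. norm z < real (Suc n) \<longrightarrow> (\<exists>w. h z = exp w \<and>
         norm w * (1 - norm z / real (Suc n)) \<le> 2 * B (3 * real (Suc n)) * (norm z / real (Suc n))))" for n
  proof -
    let ?R = "real (Suc n)"
    have "continuous_on (sphere 0 (3 * ?R)) (\<lambda>z. norm (f z))"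
      using f(1) by (intro continuous_intros holomorphic_on_imp_continuous_on holomorphic_on_subset[OF f(1)]) auto
    then obtain z\<^sub>0 where z\<^sub>0: "norm z\<^sub>0 = 3 * ?R" "\<And>z. norm z = 3 * ?R \<Longrightarrow> norm (f z) \<le> norm (f z\<^sub>0)"
      using continuous_attains_sup[OF compact_sphere, of 0 "3 * ?R" "\<lambda>z. norm (f z)"] by auto
    define M where "M = norm (f z\<^sub>0)"
    have M: "M < exp (B (3 * ?R))" using B(1)[of z\<^sub>0] by (simp only: M_def z\<^sub>0(1))
    have R: "?R > 0" "\<And>z. norm z = 3 * ?R \<Longrightarrow> norm (f z) \<le> M"
      using z\<^sub>0(2) by (auto simp: M_def)
    obtain p h where ph: "zero_product {z. f z = 0} p" "h holomorphic_on UNIV" "\<And>z. f z = p z * h z"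
      "h 0 = 1" "\<And>z. norm z \<le> ?R \<Longrightarrow> h z \<noteq> 0" "\<And>z. norm z \<le> ?R \<Longrightarrow> norm (h z) \<le> M"
      using extract_zeros[OF f R] by blast
    have "norm (h z) < exp (B (3 * ?R))" if "norm z \<le> ?R" for z using ph(6)[OF that] M by simp
    from borel_caratheodory_log[OF ph(2,4) _ ph(5) this]
    have "\<exists>w. h z = exp w \<and> norm w * (1 - norm z / ?R) \<le> 2 * B (3 * ?R) * (norm z / ?R)"
      if "norm z < ?R" for z using that by (metis of_nat_0_less_iff zero_less_Suc)
    then show ?thesis using ph by blast
  qed
  then obtain P H where P: "\<And>n. zero_product {z. f z = 0} (P n)" "\<And>n z. f z = P n z * H n z"
    and H: "\<And>n z. norm z < real (Suc n) \<Longrightarrow> \<exists>w. H n z = exp w \<and>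
         norm w * (1 - norm z / real (Suc n)) \<le> 2 * B (3 * real (Suc n)) * (norm z / real (Suc n))"
    by metis
  have "(\<lambda>n. P n z) \<longlonglongrightarrow> f z" for z
  proof -
    have "\<exists>w. \<forall>n. norm z < real (Suc n) \<longrightarrow> H n z = exp (w n) \<and>
         norm (w n) * (1 - norm z / real (Suc n)) \<le> 2 * B (3 * real (Suc n)) * (norm z / real (Suc n))"
      using H[of z] by metis
    then obtain w where w: "\<And>n. norm z < real (Suc n) \<Longrightarrow> H n z = exp (w n)"
       "\<And>n. norm z < real (Suc n) \<Longrightarrow>
         norm (w n) * (1 - norm z / real (Suc n)) \<le> 2 * B (3 * real (Suc n)) * (norm z / real (Suc n))"
      by blast
    have ev: "eventually (\<lambda>n. norm z < real (Suc n)) sequentially"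
      by real_asymp
    have t1: "(\<lambda>n. 1 - norm z / real (Suc n)) \<longlonglongrightarrow> 1" by real_asymp
    have t2: "(\<lambda>n. 2 * norm z * (B (3 * real (Suc n)) / real (Suc n)) / (1 - norm z / real (Suc n))) \<longlonglongrightarrow> 2 * norm z * 0 / 1"
      by (intro tendsto_intros t1 LIMSEQ_Suc[OF B(2)]) auto
    have "w \<longlonglongrightarrow> 0"
    proof (rule Lim_null_comparison[OF _ t2[unfolded mult_zero_right div_0]])
      show "eventually (\<lambda>n. norm (w n) \<le> 2 * norm z * (B (3 * real (Suc n)) / real (Suc n)) / (1 - norm z / real (Suc n))) sequentially"
        using ev
      proof eventually_elim
        case (elim n)
        then have "1 - norm z / real (Suc n) > 0" by simp
        with w(2)[OF elim] show ?case by (simp add: pos_le_divide_eq mult_ac)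
      qed
    qed
    \<comment> \<open>The exponential cofactor is inverted instead of dividing by f z, which may be
      0.\<close>
    then have "(\<lambda>n. f z * exp (- w n)) \<longlonglongrightarrow> f z * exp (- 0)" by (intro tendsto_intros)
    moreover have "eventually (\<lambda>n. f z * exp (- w n) = P n z) sequentially"
      using ev
    proof eventually_elim
      case (elim n)
      have "f z * exp (- w n) = P n z * (exp (w n) * exp (- w n))"
        by (simp only: P(2)[of z n] w(1)[OF elim] mult.assoc)
      then show ?case by (simp add: exp_minus)
    qed
    ultimately show ?thesis by (simp add: tendsto_cong)
  qed
  then show thesis using P(1) that by blast
qed

section \<open>Even functions with zeros in a strip\<close>

text \<open>\<open>csqrt\<close> jumps across its cut, so holomorphy is read off the power series:
  averaging at u and -u removes the odd terms and leaves a series in w = u^2.\<close>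

lemma entire_even_sqrt:
  assumes F: "F holomorphic_on UNIV" "even_function F"
  shows "(\<lambda>w. F (csqrt w)) holomorphic_on UNIV"
proof -
  define c where "c n = (deriv ^^ n) F 0 / fact n" for n
  have c: "(\<lambda>n. c n * u ^ n) sums F u" for u
    using holomorphic_power_series[of F 0 "norm u + 1" u] F(1)
    by (auto simp: c_def intro: holomorphic_on_subset)
  have even: "(\<lambda>n. c (2 * n) * w ^ n) sums F (csqrt w)" for w
  proof -
    define u where "u = csqrt w"
    define g where "g n = (c n * u ^ n + c n * (- u) ^ n) / 2" for n
    have "g sums ((F u + F (- u)) / 2)"
      unfolding g_def by (intro sums_divide sums_add c)
    then have "g sums F u" using F(2) by (simp add: even_function_def)
    moreover have "g n = 0" if "n \<notin> range (\<lambda>n. 2 * n)" for n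
    proof -
      have "odd n" using that by (metis dvdE rangeI)
      then show ?thesis by (simp add: g_def)
    qed
    ultimately have "(\<lambda>n. g (2 * n)) sums F u"
      using sums_mono_reindex[of "\<lambda>n. 2 * n" g "F u"] by (simp add: strict_mono_def)
    moreover have "g (2 * n) = c (2 * n) * w ^ n" for n
      by (simp add: g_def u_def power_mult)
    ultimately show ?thesis by (simp add: u_def)
  qed
  have hol: "(\<lambda>w. F (csqrt w)) holomorphic_on ball 0 r" for r
    by (rule power_series_holomorphic[of 0 r "\<lambda>n. c (2 * n)"]) (use even in auto)
  have "(\<lambda>w. F (csqrt w)) field_differentiable at w" for w
    by (rule holomorphic_on_imp_differentiable_at[OF hol[of "norm w + 1"]]) auto
  then show ?thesis by (simp add: holomorphic_on_def)
qed

text \<open>On the branch cut \<open>csqrt\<close> does not commute with conjugation; evenness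
  absorbs the sign.\<close>

lemma real_even_sqrt:
  assumes "real_function F" "even_function F"
  shows "F (csqrt (cnj w)) = cnj (F (csqrt w))"
proof -
  have "(csqrt (cnj w))\<^sup>2 = (cnj (csqrt w))\<^sup>2" by (simp flip: complex_cnj_power)
  then have "csqrt (cnj w) = cnj (csqrt w) \<or> csqrt (cnj w) = - cnj (csqrt w)"
    by (rule power2_eq_iff[THEN iffD1])
  then show ?thesis using assms by (auto simp: real_function_def even_function_def)
qed

section \<open>Growth bounds\<close>

lemma poly_growth: "\<exists>K c. K \<ge> 0 \<and> c \<ge> 0 \<and> (\<forall>u :: complex. norm (poly p u) \<le> K * exp (c * norm u))"
proof (induction p)
  case 0
  show ?case by (intro exI[of _ 0]) auto
next
  case (pCons a p)
  then obtain K c where K: "K \<ge> 0" "c \<ge> 0" "\<And>u. norm (poly p u) \<le> K * exp (c * norm u)" by blast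
  have "norm (poly (pCons a p) u) \<le> (norm a + K) * exp ((c + 1) * norm u)" for u
  proof -
    have "norm (poly (pCons a p) u) \<le> norm a + norm u * norm (poly p u)"
      using norm_triangle_ineq[of a "u * poly p u"] by (simp add: norm_mult)
    moreover have "norm u \<le> exp (norm u)" using exp_ge_add_one_self[of "norm u"] by linarith
    then have "norm u * norm (poly p u) \<le> exp (norm u) * (K * exp (c * norm u))"
      using K by (intro mult_mono) auto
    moreover have "norm a \<le> norm a * exp ((c + 1) * norm u)"
      using K by (simp add: mult_le_cancel_left1)
    ultimately show ?thesis by (simp add: algebra_simps exp_add)
  qed
  with K show ?case by (intro exI[of _ "norm a + K"] exI[of _ "c + 1"]) auto
qed

text \<open>The exponent 3/2 lies strictly above the order, whose infimum may not be attained, and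
  below 2, so that it becomes 3/4 < 1 in the variable u^2.\<close>

lemma order_growth:
  assumes F: "F holomorphic_on UNIV" and ord: "growth_order F \<le> 1"
  shows "\<exists>K. K \<ge> 0 \<and> (\<forall>u. norm (F u) \<le> K * exp (norm u powr (3/2)))"
proof -
  have "growth_order F < ereal (3/2)" using ord by (rule order.strict_trans1) simp
  then obtain \<rho> where \<rho>: "\<rho> < 3/2" "F \<in> O[at_infinity](\<lambda>z. complex_of_real (exp (norm z powr \<rho>)))"
    unfolding growth_order_def Inf_less_iff by auto
  then obtain c where c: "c > 0" "eventually (\<lambda>z. norm (F z) \<le> c * exp (norm z powr \<rho>)) at_infinity"
    by (auto elim!: landau_o.bigE)
  then obtain b where b: "\<And>z. b \<le> norm z \<Longrightarrow> norm (F z) \<le> c * exp (norm z powr \<rho>)"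
    by (auto simp: eventually_at_infinity)
  \<comment> \<open>Radius at least 1: outside the ball, powers of the modulus then increase with
    the exponent.\<close>
  have "continuous_on (cball 0 (max b 1)) F"
    by (intro holomorphic_on_imp_continuous_on holomorphic_on_subset[OF F]) auto
  then have "bounded (F ` cball 0 (max b 1))"
    by (intro compact_imp_bounded compact_continuous_image) auto
  then obtain d where d: "\<And>z. norm z \<le> max b 1 \<Longrightarrow> norm (F z) \<le> d"
    unfolding bounded_iff by (metis image_eqI mem_cball_0)
  have d0: "d \<ge> 0" using order.trans[OF norm_ge_zero d[of 0]] by simp
  have "norm (F u) \<le> (c + d) * exp (norm u powr (3/2))" for u
  proof (cases "norm u \<le> max b 1")
    case True
    have "d * 1 \<le> (c + d) * exp (norm u powr (3/2))"
      using c d0 by (intro mult_mono) auto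
    with d[OF True] show ?thesis by simp
  next
    case False
    have "norm (F u) \<le> c * exp (norm u powr \<rho>)" using False by (intro b) auto
    also have "\<dots> \<le> (c + d) * exp (norm u powr (3/2))"
      using c d0 False \<rho> by (intro mult_mono) (auto intro: powr_mono)
    finally show ?thesis .
  qed
  then show ?thesis using c d0 by (intro exI[of _ "c + d"]) auto
qed

lemma growth_bound:
  assumes "polynomial_function_C F \<or> (F holomorphic_on UNIV \<and> growth_order F \<le> 1)"
  obtains K c where "K \<ge> 0" "c \<ge> 0" "\<And>u. norm (F u) \<le> K * exp (c * norm u + norm u powr (3/2))"
  using assms
proof
  assume "polynomial_function_C F"
  then obtain p where p: "F = poly p" by (auto simp: polynomial_function_C_def)
  obtain K c where K: "K \<ge> 0" "c \<ge> 0" "\<And>u. norm (F u) \<le> K * exp (c * norm u)"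
    unfolding p using poly_growth by blast
  have "norm (F u) \<le> K * exp (c * norm u + norm u powr (3/2))" for u
    by (rule order.trans[OF K(3)]) (use K in \<open>auto intro: mult_left_mono\<close>)
  then show thesis using that K by blast
next
  assume "F holomorphic_on UNIV \<and> growth_order F \<le> 1"
  then obtain K where "K \<ge> 0" "\<And>u. norm (F u) \<le> K * exp (norm u powr (3/2))"
    using order_growth by blast
  then show thesis using that[of K 0] by simp
qed

section \<open>From zeros in the strip to bounds on the two ratios\<close>

lemma zero_in_parabola:
  assumes "u \<in> vstrip h"
  shows "(Re u)\<^sup>2 \<le> h\<^sup>2" "Re (u\<^sup>2) \<le> h\<^sup>2"
proof -
  show "(Re u)\<^sup>2 \<le> h\<^sup>2" using assms power_mono[of "\<bar>Re u\<bar>" h 2] by (simp add: vstrip_def)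
  moreover have "Re (u\<^sup>2) \<le> (Re u)\<^sup>2" by (simp add: power2_eq_square)
  ultimately show "Re (u\<^sup>2) \<le> h\<^sup>2" by linarith
qed

lemma norm_square_minus_real:
  "(norm (u\<^sup>2 - of_real c))\<^sup>2
   = (c - (Re u)\<^sup>2)\<^sup>2 + 2 * (Im u)\<^sup>2 * (c + (Re u)\<^sup>2) + ((Im u)\<^sup>2)\<^sup>2"
  unfolding cmod_power2 by (simp add: power2_eq_square algebra_simps)

text \<open>With u^2 = 9/4 + z, the points z = -2 and z = 4 are u = 1/2 and u = 5/2, so the two
  values are the contributions to \<open>a\<close> and \<open>b\<close>.\<close>

lemma zero_product_class:
  assumes \<nu>: "0 < \<nu>" "\<nu> < 2"
    and Z: "\<And>a. a \<in> Z \<Longrightarrow> csqrt (9/4 + a) \<in> vstrip (h_opt \<nu>)"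
    and p: "zero_product Z p"
  shows "\<exists>a b. p (- 2) = of_real a \<and> p 4 = of_real b \<and> (a, b) \<in> pos_class \<nu> \<union> neg_class \<nu>"
  using p
proof induction
  case one
  show ?case using pos_class_one[OF \<nu>(1)] by (intro exI[of _ 1]) auto
next
  case (real_zero p z)
  then obtain a b where ab: "p (- 2) = of_real a" "p 4 = of_real b" "(a, b) \<in> pos_class \<nu> \<union> neg_class \<nu>"
    by blast
  obtain t where t: "z = of_real t" using real_zero by (auto elim: Reals_cases)
  have "Re ((csqrt (9/4 + z))\<^sup>2) \<le> (h_opt \<nu>)\<^sup>2" by (intro zero_in_parabola Z real_zero)
  then have "9/4 + t \<le> (h_opt \<nu>)\<^sup>2" by (simp add: t)
  moreover have "(1/4 - (9/4 + t)) / (9/4 - (9/4 + t)) = 1 + 2 / t"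
    "(25/4 - (9/4 + t)) / (9/4 - (9/4 + t)) = 1 - 4 / t"
    using real_zero(4) by (simp_all add: t field_simps)
  ultimately have "(1 + 2 / t, 1 - 4 / t) \<in> pos_class \<nu> \<union> neg_class \<nu>"
    using class_real_factor[OF \<nu>, of "9/4 + t"] by simp
  from class_mult[OF \<nu> ab(3) this]
  have "(a * (1 + 2 / t), b * (1 - 4 / t)) \<in> pos_class \<nu> \<union> neg_class \<nu>" .
  moreover have "p (- 2) * (1 - (- 2) / z) = of_real (a * (1 + 2 / t))"
    "p 4 * (1 - 4 / z) = of_real (b * (1 - 4 / t))"
    by (simp_all add: ab t)
  ultimately show ?case by blast
next
  case (conj_zeros p z)
  then obtain a b where ab: "p (- 2) = of_real a" "p 4 = of_real b" "(a, b) \<in> pos_class \<nu> \<union> neg_class \<nu>"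
    by blast
  define u where "u = csqrt (9/4 + z)"
  have z: "z = u\<^sup>2 - of_real (9/4)" by (simp add: u_def)
  have "u \<in> vstrip (h_opt \<nu>)" using Z conj_zeros by (simp add: u_def)
  then have S: "(Re u)\<^sup>2 \<le> (h_opt \<nu>)\<^sup>2" by (rule zero_in_parabola)
  have z0: "z \<noteq> 0" using conj_zeros by auto
  define N where "N c = (norm (u\<^sup>2 - of_real c))\<^sup>2" for c :: real
  have fac: "(1 - of_real x / z) * (1 - of_real x / cnj z) = of_real (N (9/4 + x) / N (9/4))" for x
  proof -
    have "(1 - of_real x / z) * (1 - of_real x / cnj z) = ((z - of_real x) * cnj (z - of_real x)) / (z * cnj z)"
      using z0 by (simp add: field_simps)
    also have "\<dots> = of_real ((norm (z - of_real x))\<^sup>2 / (norm z)\<^sup>2)"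
      by (simp only: complex_norm_square of_real_divide)
    finally show ?thesis by (simp add: N_def z algebra_simps)
  qed
  have "(N (1/4) / N (9/4), N (25/4) / N (9/4)) \<in> pos_class \<nu>"
    unfolding N_def norm_square_minus_real by (rule class_complex_factor[OF \<nu> _ S]) auto
  then have "(a * (N (1/4) / N (9/4)), b * (N (25/4) / N (9/4))) \<in> pos_class \<nu> \<union> neg_class \<nu>"
    by (intro class_mult[OF \<nu> ab(3)]) auto
  moreover have "p (- 2) * ((1 - (- 2) / z) * (1 - (- 2) / cnj z)) = of_real (a * (N (1/4) / N (9/4)))"
    "p 4 * ((1 - 4 / z) * (1 - 4 / cnj z)) = of_real (b * (N (25/4) / N (9/4)))"
    using fac[of "- 2"] fac[of 4] by (simp_all add: ab)
  ultimately show ?case by blast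
qed

lemma csqrt_values: "csqrt (1/4) = 1/2" "csqrt (9/4) = 3/2" "csqrt (25/4) = 5/2"
proof -
  have "csqrt ((of_real x)\<^sup>2) = of_real x" if "x \<ge> 0" for x :: real
    using that by (intro csqrt_square) auto
  from this[of "1/2"] this[of "3/2"] this[of "5/2"]
  show "csqrt (1/4) = 1/2" "csqrt (9/4) = 3/2" "csqrt (25/4) = 5/2"
    by (simp_all add: power2_eq_square)
qed

lemma multiplier_ratio_bounds:
  assumes \<nu>: "0 < \<nu>" "\<nu> < 2" and F: "real_function F" "even_function F"
    "polynomial_function_C F \<or> (F holomorphic_on UNIV \<and> growth_order F \<le> 1)"
    and Z: "zero_set F \<subseteq> vstrip (h_opt \<nu>)"
  obtains A a b where "A \<noteq> 0" "Re (F (1/2)) = A * a" "Re (F (3/2)) = A" "Re (F (5/2)) = A * b"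
    "x_sharp \<nu> \<le> a" "a \<le> 1" "1 \<le> b" "b * ratio_quad \<nu> a \<le> (1 + \<nu>) * a"
proof -
  have hol: "F holomorphic_on UNIV"
    using F(3) by (auto simp: polynomial_function_C_def intro!: holomorphic_intros)
  obtain K c where K: "K \<ge> 0" "c \<ge> 0" "\<And>u. norm (F u) \<le> K * exp (c * norm u + norm u powr (3/2))"
    using growth_bound[OF F(3)] by blast
  have re: "F (of_real x) = of_real (Re (F (of_real x)))" for x
    using F(1) by (metis complex_cnj_complex_of_real complex_is_Real_iff Reals_cnj_iff of_real_Re real_function_def)
  define A where "A = Re (F (3/2))"
  have FA: "F (3/2) = of_real A" using re[of "3/2"] by (simp add: A_def)
  \<comment> \<open>The strip has half-width below 3/2, so the denominator F(3/2) of both ratios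
    does not vanish.\<close>
  have "(3/2 :: complex) \<notin> vstrip (h_opt \<nu>)"
  proof
    assume "(3/2 :: complex) \<in> vstrip (h_opt \<nu>)"
    from zero_in_parabola(1)[OF this] have "9/4 \<le> (h_opt \<nu>)\<^sup>2" by (simp add: power2_eq_square)
    then show False using alpha_sharp_bounds[OF \<nu>] h_opt_sq(2)[OF \<nu>] by linarith
  qed
  then have "F (3/2) \<noteq> 0" using Z by (auto simp: zero_set_def)
  then have A0: "A \<noteq> 0" using FA by auto
  define f where "f z = F (csqrt (9/4 + z)) / of_real A" for z
  have "((\<lambda>w. F (csqrt w)) \<circ> (\<lambda>z. 9/4 + z)) holomorphic_on UNIV"
    by (intro holomorphic_on_compose_gen[OF _ entire_even_sqrt[OF hol F(2)]] holomorphic_intros) auto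
  then have f1: "f holomorphic_on UNIV"
    unfolding f_def o_def using A0 by (intro holomorphic_intros) auto
  have "cnj (9/4 + z) = 9/4 + cnj z" for z by simp
  then have f2: "real_function f"
    unfolding real_function_def f_def
    using real_even_sqrt[OF F(1,2), of "9/4 + _"] by simp
  have f3: "f 0 = 1" using FA A0 by (simp add: f_def csqrt_values)
  \<comment> \<open>The constant K / |A| is absorbed through K / |A| < exp (K / |A|), which also
    makes the bound strict. All terms are o(r).\<close>
  define B where "B r = K / \<bar>A\<bar> + c * sqrt (9/4 + r) + (9/4 + r) powr (3/4)" for r
  have fB: "norm (f z) < exp (B (norm z))" for z
  proof -
    have le: "norm (9/4 + z) \<le> 9/4 + norm z" using norm_triangle_ineq[of "9/4" z] by simp
    have "norm (F (csqrt (9/4 + z))) \<le> K * exp (c * norm (csqrt (9/4 + z)) + norm (csqrt (9/4 + z)) powr (3/2))"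
      by (rule K)
    also have "norm (csqrt (9/4 + z)) powr (3/2) = norm (9/4 + z) powr (3/4)"
      by (simp add: powr_half_sqrt[symmetric] powr_powr)
    also have "K * exp (c * norm (csqrt (9/4 + z)) + norm (9/4 + z) powr (3/4))
        \<le> K * exp (c * sqrt (9/4 + norm z) + (9/4 + norm z) powr (3/4))"
      using K le by (intro mult_left_mono) (auto intro!: add_mono mult_left_mono powr_mono2)
    finally have "norm (f z) \<le> K / \<bar>A\<bar> * exp (c * sqrt (9/4 + norm z) + (9/4 + norm z) powr (3/4))"
      using A0 by (simp add: f_def norm_divide divide_right_mono)
    also have "K / \<bar>A\<bar> < exp (K / \<bar>A\<bar>)"
      using exp_ge_add_one_self[of "K / \<bar>A\<bar>"] by linarith
    then have "K / \<bar>A\<bar> * exp (c * sqrt (9/4 + norm z) + (9/4 + norm z) powr (3/4))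
        < exp (K / \<bar>A\<bar>) * exp (c * sqrt (9/4 + norm z) + (9/4 + norm z) powr (3/4))"
      by (intro mult_strict_right_mono) auto
    also have "\<dots> = exp (B (norm z))" by (simp add: B_def exp_add)
    finally show ?thesis .
  qed
  have B0: "(\<lambda>n. B (3 * real n) / real n) \<longlonglongrightarrow> 0"
  proof -
    have "(\<lambda>n. K / \<bar>A\<bar> / real n + c * (sqrt (9/4 + 3 * real n) / real n) + (9/4 + 3 * real n) powr (3/4) / real n)
      \<longlonglongrightarrow> 0 + c * 0 + 0"
      by (intro tendsto_intros) real_asymp+
    then show ?thesis by (simp add: B_def add_divide_distrib)
  qed
  obtain P where P: "\<And>n. zero_product {z. f z = 0} (P n)" "\<And>z. (\<lambda>n. P n z) \<longlonglongrightarrow> f z"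
    using zero_product_limit[OF f1 f2 f3 fB B0] by blast
  have "\<exists>a b. P n (- 2) = of_real a \<and> P n 4 = of_real b \<and> (a, b) \<in> pos_class \<nu> \<union> neg_class \<nu>" for n
    by (rule zero_product_class[OF \<nu> _ P(1)]) (use Z A0 in \<open>auto simp: f_def zero_set_def\<close>)
  then obtain s r where sr: "\<And>n. P n (- 2) = of_real (s n)" "\<And>n. P n 4 = of_real (r n)"
    "\<And>n. (s n, r n) \<in> pos_class \<nu> \<union> neg_class \<nu>" by metis
  note bds = class_bounds[OF \<nu> sr(3)]
  define a b where "a = Re (f (- 2))" and "b = Re (f 4)"
  have s: "s \<longlonglongrightarrow> a" and r: "r \<longlonglongrightarrow> b"
    using tendsto_Re[OF P(2)[of "- 2"]] tendsto_Re[OF P(2)[of 4]] by (simp_all add: sr a_def b_def)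
  have "x_sharp \<nu> \<le> a" by (rule LIMSEQ_le_const[OF s]) (use bds in auto)
  moreover have "a \<le> 1" by (rule LIMSEQ_le_const2[OF s]) (use bds in auto)
  moreover have "1 \<le> b" by (rule LIMSEQ_le_const[OF r]) (use bds in auto)
  moreover have "b * ratio_quad \<nu> a \<le> (1 + \<nu>) * a"
  proof (rule LIMSEQ_le)
    show "(\<lambda>n. r n * ratio_quad \<nu> (s n)) \<longlonglongrightarrow> b * ratio_quad \<nu> a" unfolding ratio_quad_def by (intro tendsto_intros r s)
    show "(\<lambda>n. (1 + \<nu>) * s n) \<longlonglongrightarrow> (1 + \<nu>) * a" by (intro tendsto_intros s)
  qed (use bds in auto)
  moreover have "Re (F (1/2)) = A * a" "Re (F (5/2)) = A * b"
    using A0 by (simp_all add: a_def b_def f_def csqrt_values)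
  ultimately show thesis using that[of A a b] A0 A_def by blast
qed

section \<open>Quadratic pencils and the multiplier\<close>

lemma jacobi_eigenpoly_eqI:
  assumes "degree p = r" "lead_coeff p = 1" "jacobi_op \<nu> p = smult (of_nat r * (of_nat r + 1)) p"
  shows "jacobi_eigenpoly \<nu> r = p"
  using ex1_jacobi_eigenpoly[of r \<nu>] assms
    degree_jacobi_eigenpoly lead_coeff_jacobi_eigenpoly jacobi_op_eigenpoly by metis

lemma jacobi_eigenpoly_0: "jacobi_eigenpoly \<nu> 0 = 1"
  by (rule jacobi_eigenpoly_eqI) (auto simp: jacobi_op_def pderiv_1)

lemma jacobi_eigenpoly_1: "jacobi_eigenpoly \<nu> 1 = [:- 2 * \<nu>, 1:]"
  by (rule jacobi_eigenpoly_eqI) (auto simp: jacobi_op_def pderiv_pCons)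

lemma jacobi_eigenpoly_2:
  "jacobi_eigenpoly \<nu> 2 = [:4/3 * \<nu> * (1 + \<nu>), - 2 * (1 + \<nu>), 1:]"
  by (rule jacobi_eigenpoly_eqI) (auto simp: jacobi_op_def pderiv_pCons algebra_simps)

lemma multiplier_op_add: "multiplier_op F \<nu> (p + r) = multiplier_op F \<nu> p + multiplier_op F \<nu> r"
  and multiplier_op_smult: "multiplier_op F \<nu> (smult k p) = smult k (multiplier_op F \<nu> p)"
proof -
  interpret L: Vector_Spaces.linear smult smult "multiplier_op F \<nu>" by (rule linear_multiplier_op)
  show "multiplier_op F \<nu> (p + r) = multiplier_op F \<nu> p + multiplier_op F \<nu> r"
    "multiplier_op F \<nu> (smult k p) = smult k (multiplier_op F \<nu> p)"
    by (rule L.add L.scale)+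
qed

context
  fixes \<nu> :: real and F :: "complex \<Rightarrow> complex" and A a b y\<^sub>0 c\<^sub>0 c\<^sub>1 :: real
  assumes F: "Re (F (1/2)) = A * a" "Re (F (3/2)) = A" "Re (F (5/2)) = A * b"
  defines "y\<^sub>0 \<equiv> 2 * \<nu> * (1 - a)"
    and "c\<^sub>0 \<equiv> 4/3 * \<nu> * (1 + \<nu>) * (b - 3 + 2 * a)" and "c\<^sub>1 \<equiv> 2 * (1 + \<nu>) * (1 - b)"
begin

lemma multiplier_op_P:
  "multiplier_op F \<nu> 1 = [:A * a:]"
  "multiplier_op F \<nu> [:- 2 * \<nu>, 1:] = smult A [:- 2 * \<nu>, 1:]"
  "multiplier_op F \<nu> [:4/3 * \<nu> * (1 + \<nu>), - 2 * (1 + \<nu>), 1:]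
     = smult (A * b) [:4/3 * \<nu> * (1 + \<nu>), - 2 * (1 + \<nu>), 1:]"
  using multiplier_op_eigenpoly[of F \<nu> 0] multiplier_op_eigenpoly[of F \<nu> 1]
    multiplier_op_eigenpoly[of F \<nu> 2] F
  unfolding jacobi_eigenpoly_0 jacobi_eigenpoly_1 jacobi_eigenpoly_2
  by (simp_all add: one_pCons)

lemma multiplier_op_y: "multiplier_op F \<nu> [:0, 1:] = smult A [:- y\<^sub>0, 1:]"
proof -
  have "[:0, 1:] = [:- 2 * \<nu>, 1:] + smult (2 * \<nu>) 1" by (simp add: one_pCons)
  then show ?thesis
    by (simp only: multiplier_op_add multiplier_op_smult multiplier_op_P)
       (simp add: y\<^sub>0_def algebra_simps)
qed

lemma multiplier_op_y2: "multiplier_op F \<nu> ([:0, 1:] ^ 2) = smult A [:c\<^sub>0, c\<^sub>1, b:]"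
proof -
  have "[:0, 1:] ^ 2 = [:4/3 * \<nu> * (1 + \<nu>), - 2 * (1 + \<nu>), 1:]
     + (smult (2 * (1 + \<nu>)) [:- 2 * \<nu>, 1:] + smult (8/3 * \<nu> * (1 + \<nu>)) 1)"
    by (simp add: one_pCons power2_eq_square field_simps)
  then show ?thesis
    by (simp only: multiplier_op_add multiplier_op_smult multiplier_op_P)
       (simp add: c\<^sub>0_def c\<^sub>1_def field_simps)
qed

lemma multiplier_op_pencil:
  "multiplier_op F \<nu> ([:0, 1:] ^ 2) + smult t (multiplier_op F \<nu> [:0, 1:])
     = smult A [:c\<^sub>0 - t * y\<^sub>0, c\<^sub>1 + t, b:]"
  by (simp add: multiplier_op_y multiplier_op_y2 algebra_simps)

lemma multiplier_op_yt:
  "multiplier_op F \<nu> ([:0, 1:] * [:t, 1:]) = smult A [:c\<^sub>0 - t * y\<^sub>0, c\<^sub>1 + t, b:]"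
proof -
  have "[:0, 1:] * [:t, 1:] = [:0, 1:] ^ 2 + smult t [:0, 1::real:]"
    by (simp add: power2_eq_square)
  then show ?thesis
    by (simp only: multiplier_op_add multiplier_op_smult multiplier_op_pencil)
qed

lemma pencil_at_y\<^sub>0:
  "b * y\<^sub>0\<^sup>2 + c\<^sub>1 * y\<^sub>0 + c\<^sub>0 = 4 * \<nu> / 3 * (b * ratio_quad \<nu> a - (1 + \<nu>) * a)"
  by (simp add: y\<^sub>0_def c\<^sub>0_def c\<^sub>1_def ratio_quad_def field_simps power2_eq_square)

text \<open>For any member Q of the normalized pencil, four times the left side is (4 -
  \<open>y\<^sub>0\<close>) Q(0) + \<open>y\<^sub>0\<close> Q(4); these weights cancel t, since t
  multiplies y - \<open>y\<^sub>0\<close>.\<close>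

lemma pencil_endpoints:
  "c\<^sub>0 + y\<^sub>0 * (4 * b + c\<^sub>1) = 4 * \<nu> / 3 * ((1 + \<nu>) * (b - a) + 3 * (1 - \<nu>) * (1 - a) * b)"
  by (simp add: y\<^sub>0_def c\<^sub>0_def c\<^sub>1_def field_simps power2_eq_square)

end

section \<open>Zeros of the real quadratics in a pencil\<close>

lemma cpoly_linear_product:
  "cpoly (smult K ([:- r, 1:] * [:- s, 1:])) = smult (of_real K) ([:- of_real r, 1:] * [:- of_real s, 1:])"
  by (simp add: map_poly_pCons map_poly_smult)

lemma poly_cpoly_linear_product:
  "poly (cpoly (smult K ([:- r, 1:] * [:- s, 1:]))) z = of_real K * ((z - of_real r) * (z - of_real s))"
  unfolding cpoly_linear_product poly_smult poly_mult by simp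

lemma split_quadratic_real_zeros: "only_real_zeros (smult K ([:- r, 1:] * [:- s, 1:]))"
  if "K \<noteq> 0"
  using that unfolding only_real_zeros_def poly_cpoly_linear_product by auto

lemma split_quadratic_in_E2:
  assumes K: "K \<noteq> 0" and r: "r \<in> {0..4}"
  shows "smult K ([:- r, 1:] * [:- s, 1:]) \<in> E2"
proof -
  let ?Q = "smult K ([:- r, 1:] * [:- s, 1:])"
  have z: "zeros_outside ?Q \<subseteq> {of_real s}"
    using K r unfolding zeros_outside_def poly_cpoly_linear_product by auto
  have "(\<Sum>z\<in>zeros_outside ?Q. order z (cpoly ?Q)) \<le> 1"
  proof (cases "zeros_outside ?Q = {}")
    case False
    with z have eq: "zeros_outside ?Q = {of_real s}" by auto
    then have "complex_of_real s \<in> zeros_outside ?Q" by blast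
    then have "complex_of_real s \<notin> of_real ` {0..4}"
      by (simp only: zeros_outside_def mem_Collect_eq not_False_eq_True)
    then have "r \<noteq> s" using r by blast
    then have "order (complex_of_real s) [:- of_real r, 1:] = 0" by (intro order_0I) simp
    moreover have "order (complex_of_real s) [:- of_real s, 1:] = 1"
      using order_power_n_n[of "complex_of_real s" 1] by simp
    moreover have "[:- complex_of_real r, 1:] * [:- of_real s, 1:] \<noteq> 0"
      by (simp only: mult_eq_0_iff) simp
    ultimately have "order (of_real s) (cpoly ?Q) = 1"
      unfolding cpoly_linear_product using K
      by (simp add: order_smult order_mult del: mult_pCons_left mult_pCons_right)
    then show ?thesis unfolding eq by simp
  qed simp
  moreover have "degree ?Q \<le> 2" by simp
  ultimately show ?thesis by (simp add: E2_def)
qed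

text \<open>With b > 0, a nonpositive value at \<open>y\<^sub>0\<close> gives real zeros on both
  sides of \<open>y\<^sub>0\<close>. If both missed [0,4], the quadratic would be negative at 0 and
  at 4, against the weighted mean of these values.\<close>

lemma pencil_good:
  fixes b y\<^sub>0 c\<^sub>0 c\<^sub>1 :: real
  assumes A: "A \<noteq> 0" and b: "b > 0" and y: "0 \<le> y\<^sub>0" "y\<^sub>0 \<le> 4"
    and disc: "b * y\<^sub>0\<^sup>2 + c\<^sub>1 * y\<^sub>0 + c\<^sub>0 \<le> 0" and ends: "c\<^sub>0 + y\<^sub>0 * (4 * b + c\<^sub>1) \<ge> 0"
  shows "smult A [:c\<^sub>0 - t * y\<^sub>0, c\<^sub>1 + t, b:] \<in> E2"
    "only_real_zeros (smult A [:c\<^sub>0 - t * y\<^sub>0, c\<^sub>1 + t, b:])"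
proof -
  define B C where "B = c\<^sub>1 + t" and "C = c\<^sub>0 - t * y\<^sub>0"
  have Qy: "b * y\<^sub>0\<^sup>2 + B * y\<^sub>0 + C \<le> 0" using disc by (simp add: B_def C_def algebra_simps)
  define D where "D = B\<^sup>2 - 4 * b * C"
  have "(2 * b * y\<^sub>0 + B)\<^sup>2 - D = 4 * b * (b * y\<^sub>0\<^sup>2 + B * y\<^sub>0 + C)"
    by (simp add: D_def power2_eq_square algebra_simps)
  also have "\<dots> \<le> 0" using Qy b by (intro mult_nonneg_nonpos) auto
  finally have D: "D \<ge> 0" using zero_le_power2[of "2 * b * y\<^sub>0 + B"] by linarith
  define r s where "r = (- B - sqrt D) / (2 * b)" and "s = (- B + sqrt D) / (2 * b)"
  have sum: "b * (r + s) = - B" and prod: "b * (r * s) = C"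
  proof -
    show "b * (r + s) = - B" using b by (simp add: r_def s_def field_simps)
    have "4 * b * (b * (r * s)) = (- B - sqrt D) * (- B + sqrt D)" using b by (simp add: r_def s_def)
    also have "\<dots> = B\<^sup>2 - D" using D by (simp add: algebra_simps power2_eq_square)
    finally have "4 * b * (b * (r * s)) = 4 * b * C" by (simp add: D_def)
    then show "b * (r * s) = C" using b by simp
  qed
  have BC: "B = - (b * (r + s))" "C = b * (r * s)" using sum prod by simp_all
  have ev: "b * x\<^sup>2 + B * x + C = b * ((x - r) * (x - s))" for x
    unfolding BC by (simp add: power2_eq_square algebra_simps)
  have Q: "smult A [:C, B, b:] = smult (A * b) ([:- r, 1:] * [:- s, 1:])"
    unfolding BC by (simp add: algebra_simps)
  have rs: "r \<le> s" using b D by (simp add: r_def s_def divide_right_mono)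
  have "(y\<^sub>0 - r) * (y\<^sub>0 - s) \<le> 0" using Qy b unfolding ev by (simp add: mult_le_0_iff)
  then have rys: "r \<le> y\<^sub>0" "y\<^sub>0 \<le> s" using rs by (auto simp: mult_le_0_iff)
  have "r \<in> {0..4} \<or> s \<in> {0..4}"
  proof (rule ccontr)
    assume "\<not> ?thesis"
    then have out: "r < 0" "s > 4" using rys y by auto
    have neg: "b * 0\<^sup>2 + B * 0 + C < 0" "b * 4\<^sup>2 + B * 4 + C < 0"
      unfolding ev using out b rs by (auto intro!: mult_pos_neg mult_neg_pos simp: mult_less_0_iff)
    have "0 \<le> 4 * (c\<^sub>0 + y\<^sub>0 * (4 * b + c\<^sub>1))" using ends by simp
    also have "\<dots> = (4 - y\<^sub>0) * (b * 0\<^sup>2 + B * 0 + C) + y\<^sub>0 * (b * 4\<^sup>2 + B * 4 + C)"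
      by (simp add: B_def C_def algebra_simps)
    also have "\<dots> < 0"
    \<comment> \<open>Strictness needs a positive weight: that of the value at 4 if
      \<open>y\<^sub>0\<close> > 0, that of the value at 0 otherwise.\<close>
    proof (cases "y\<^sub>0 = 0")
      case False
      then show ?thesis
        using y by (intro add_nonpos_neg mult_nonneg_nonpos[OF _ less_imp_le[OF neg(1)]] mult_pos_neg[OF _ neg(2)]) auto
    qed (use neg in simp)
    finally show False by simp
  qed
  then show "smult A [:c\<^sub>0 - t * y\<^sub>0, c\<^sub>1 + t, b:] \<in> E2"
    unfolding B_def[symmetric] C_def[symmetric] Q
    using split_quadratic_in_E2[of "A * b" r s] split_quadratic_in_E2[of "A * b" s r] A b
    by (metis less_irrefl mult.commute mult_eq_0_iff)
  show "only_real_zeros (smult A [:c\<^sub>0 - t * y\<^sub>0, c\<^sub>1 + t, b:])"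
    unfolding B_def[symmetric] C_def[symmetric] Q
    by (rule split_quadratic_real_zeros) (use A b in simp)
qed

lemma pencil_bad:
  fixes b y\<^sub>0 c\<^sub>0 c\<^sub>1 :: real
  assumes A: "A \<noteq> 0" and b: "b > 0" and disc: "b * y\<^sub>0\<^sup>2 + c\<^sub>1 * y\<^sub>0 + c\<^sub>0 > 0"
  obtains t where "smult A [:c\<^sub>0 - t * y\<^sub>0, c\<^sub>1 + t, b:] \<noteq> 0"
    "\<not> only_real_zeros (smult A [:c\<^sub>0 - t * y\<^sub>0, c\<^sub>1 + t, b:])"
    "smult A [:c\<^sub>0 - t * y\<^sub>0, c\<^sub>1 + t, b:] \<notin> E2"
proof
  \<comment> \<open>This t puts the vertex at \<open>y\<^sub>0\<close>; the minimum is positive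
    there, so the zeros are \<open>y\<^sub>0\<close> + i d and \<open>y\<^sub>0\<close> - i
    d.\<close>
  define t where "t = - 2 * b * y\<^sub>0 - c\<^sub>1"
  define d where "d = sqrt ((b * y\<^sub>0\<^sup>2 + c\<^sub>1 * y\<^sub>0 + c\<^sub>0) / b)"
  let ?Q = "smult A [:c\<^sub>0 - t * y\<^sub>0, c\<^sub>1 + t, b:]"
  have d: "d > 0" "b * d\<^sup>2 = b * y\<^sub>0\<^sup>2 + c\<^sub>1 * y\<^sub>0 + c\<^sub>0" using disc b by (auto simp: d_def)
  have Q: "cpoly ?Q = smult (of_real (A * b)) ([:- Complex y\<^sub>0 d, 1:] * [:- Complex y\<^sub>0 (- d), 1:])"
  proof -
    have "b * (y\<^sub>0\<^sup>2 + d\<^sup>2) = c\<^sub>0 - t * y\<^sub>0"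
      unfolding distrib_left d(2) by (simp add: t_def power2_eq_square algebra_simps)
    moreover have "c\<^sub>1 + t = - 2 * b * y\<^sub>0" by (simp add: t_def)
    ultimately show ?thesis
      by (simp add: map_poly_pCons map_poly_smult complex_eq_iff power2_eq_square mult.assoc)
  qed
  have z: "poly (cpoly ?Q) (Complex y\<^sub>0 d) = 0" "poly (cpoly ?Q) (Complex y\<^sub>0 (- d)) = 0"
    unfolding Q poly_smult poly_mult by simp_all
  show Q0: "?Q \<noteq> 0" using A b by simp
  show "\<not> only_real_zeros ?Q"
    using z(1) d(1) unfolding only_real_zeros_def by (auto simp: complex_is_Real_iff)
  show "?Q \<notin> E2"
  proof
    assume "?Q \<in> E2"
    then have le: "(\<Sum>z\<in>zeros_outside ?Q. order z (cpoly ?Q)) \<le> 1" using Q0 unfolding E2_def by blast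
    have c0: "cpoly ?Q \<noteq> 0" using Q0 by (simp add: map_poly_eq_0_iff)
    have fin: "finite (zeros_outside ?Q)"
      by (rule finite_subset[OF _ poly_roots_finite[OF c0]]) (auto simp: zeros_outside_def)
    let ?S = "{Complex y\<^sub>0 d, Complex y\<^sub>0 (- d)}"
    have sub: "?S \<subseteq> zeros_outside ?Q"
      using z d(1) by (auto simp: zeros_outside_def complex_eq_iff)
    have "2 = card ?S" using d(1) by simp
    also have "\<dots> = (\<Sum>z\<in>?S. 1)" by simp
    also have "\<dots> \<le> (\<Sum>z\<in>?S. order z (cpoly ?Q))"
      using z c0 by (intro sum_mono) (auto simp: Suc_le_eq order_gt_0_iff)
    also have "\<dots> \<le> (\<Sum>z\<in>zeros_outside ?Q. order z (cpoly ?Q))"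
      by (rule sum_mono2[OF fin sub]) auto
    finally show False using le by simp
  qed
qed

section \<open>The inclusion and its sharpness\<close>

lemma multiplier_in_E2:
  assumes \<nu>: "0 < \<nu>" "\<nu> < 2" and F: "real_function F" "even_function F"
    "polynomial_function_C F \<or> (F holomorphic_on UNIV \<and> growth_order F \<le> 1)"
    "zero_set F \<subseteq> vstrip (h_opt \<nu>)"
  shows "multiplier_op F \<nu> ([:0, 1:] * [:t, 1:]) \<in> E2"
    "multiplier_op F \<nu> [:0, 1:] \<preceq>\<^sub>O multiplier_op F \<nu> ([:0, 1:] ^ 2)"
proof -
  obtain A a b where A: "A \<noteq> 0" and vals: "Re (F (1/2)) = A * a" "Re (F (3/2)) = A" "Re (F (5/2)) = A * b"
    and ab: "x_sharp \<nu> \<le> a" "a \<le> 1" "1 \<le> b" "b * ratio_quad \<nu> a \<le> (1 + \<nu>) * a"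
    by (rule multiplier_ratio_bounds[OF \<nu> F]) blast
  have lower: "2 - \<nu> + 2 * \<nu> * a \<ge> 0"
  proof -
    have "2 * \<nu> * x_sharp \<nu> \<le> 2 * \<nu> * a" using ab \<nu> by simp
    then show ?thesis using x_sharp_bounds(3)[OF \<nu>] by linarith
  qed
  \<comment> \<open>The bound behind \<open>alpha_sing\<close> also locates the zero of M(y): it is
    at most 2 + \<nu> < 4.\<close>
  have y: "0 \<le> 2 * \<nu> * (1 - a)" "2 * \<nu> * (1 - a) \<le> 4"
  proof -
    show "0 \<le> 2 * \<nu> * (1 - a)" using \<nu> ab by simp
    have "2 * \<nu> * (1 - a) = 2 * \<nu> - 2 * \<nu> * a" by (simp add: algebra_simps)
    then show "2 * \<nu> * (1 - a) \<le> 4" using lower \<nu> by linarith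
  qed
  have ends: "(1 + \<nu>) * (b - a) + 3 * (1 - \<nu>) * (1 - a) * b \<ge> 0"
  proof (cases "\<nu> \<le> 1")
    case True
    then show ?thesis using \<nu> ab by simp
  next
    case False
    \<comment> \<open>For \<nu> > 1 the second summand is nonpositive. The expression is affine in b
      with slope \<kappa>, and at b = 1 it equals (4 - 2 \<nu>) (1 - a).\<close>
    define \<kappa> where "\<kappa> = 4 - 2 * \<nu> + 3 * (\<nu> - 1) * a"
    have "2 * \<nu> * \<kappa> = 3 * (\<nu> - 1) * (2 - \<nu> + 2 * \<nu> * a) + (2 - \<nu>) * (\<nu> + 3)"
      by (simp add: \<kappa>_def algebra_simps)
    also have "\<dots> \<ge> 0" using False lower \<nu> by simp
    finally have "\<kappa> \<ge> 0" using \<nu> by (simp add: zero_le_mult_iff)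
    then have "(b - 1) * \<kappa> + (4 - 2 * \<nu>) * (1 - a) \<ge> 0" using ab \<nu> by simp
    also have "(b - 1) * \<kappa> + (4 - 2 * \<nu>) * (1 - a) = (1 + \<nu>) * (b - a) + 3 * (1 - \<nu>) * (1 - a) * b"
      by (simp add: \<kappa>_def algebra_simps)
    finally show ?thesis .
  qed
  have d: "b * (2 * \<nu> * (1 - a))\<^sup>2 + 2 * (1 + \<nu>) * (1 - b) * (2 * \<nu> * (1 - a))
      + 4/3 * \<nu> * (1 + \<nu>) * (b - 3 + 2 * a) \<le> 0"
    unfolding pencil_at_y\<^sub>0[OF vals] using ab(4) \<nu> by (simp add: mult_le_0_iff)
  have e: "4/3 * \<nu> * (1 + \<nu>) * (b - 3 + 2 * a)
      + 2 * \<nu> * (1 - a) * (4 * b + 2 * (1 + \<nu>) * (1 - b)) \<ge> 0"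
    unfolding pencil_endpoints[OF vals] using ends \<nu> by simp
  have b: "b > 0" using ab by simp
  note good = pencil_good[OF A b y d e]
  show "multiplier_op F \<nu> ([:0, 1:] * [:t, 1:]) \<in> E2"
    unfolding multiplier_op_yt[OF vals] by (rule good)
  show "multiplier_op F \<nu> [:0, 1:] \<preceq>\<^sub>O multiplier_op F \<nu> ([:0, 1:] ^ 2)"
    unfolding weak_obreschkoff_def multiplier_op_pencil[OF vals] using good(2) by blast
qed

lemma multiplier_fails:
  assumes \<nu>: "0 < \<nu>" and A: "A \<noteq> 0" and b: "b > 0" and ab: "b * ratio_quad \<nu> a > (1 + \<nu>) * a"
    and vals: "Re (F (1/2)) = A * a" "Re (F (3/2)) = A" "Re (F (5/2)) = A * b"
  shows "\<not> (multiplier_op F \<nu> [:0, 1:] \<preceq>\<^sub>O multiplier_op F \<nu> ([:0, 1:] ^ 2))"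
    "\<not> (\<forall>t. multiplier_op F \<nu> ([:0, 1:] * [:t, 1:]) \<in> E2)"
proof -
  have d: "b * (2 * \<nu> * (1 - a))\<^sup>2 + 2 * (1 + \<nu>) * (1 - b) * (2 * \<nu> * (1 - a))
      + 4/3 * \<nu> * (1 + \<nu>) * (b - 3 + 2 * a) > 0"
    unfolding pencil_at_y\<^sub>0[OF vals] using ab \<nu> by simp
  from pencil_bad[OF A b d] obtain t where t:
    "multiplier_op F \<nu> ([:0, 1:] ^ 2) + smult t (multiplier_op F \<nu> [:0, 1:]) \<noteq> 0"
    "\<not> only_real_zeros (multiplier_op F \<nu> ([:0, 1:] ^ 2) + smult t (multiplier_op F \<nu> [:0, 1:]))"
    "multiplier_op F \<nu> ([:0, 1:] * [:t, 1:]) \<notin> E2"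
    unfolding multiplier_op_pencil[OF vals] multiplier_op_yt[OF vals] .
  show "\<not> (multiplier_op F \<nu> [:0, 1:] \<preceq>\<^sub>O multiplier_op F \<nu> ([:0, 1:] ^ 2))"
    unfolding weak_obreschkoff_def using t(1,2) by blast
  show "\<not> (\<forall>t. multiplier_op F \<nu> ([:0, 1:] * [:t, 1:]) \<in> E2)"
    using t(3) by blast
qed

lemma sharpness_witness:
  assumes \<nu>: "0 < \<nu>" "\<nu> < 2" and H: "H > h_opt \<nu>"
  obtains F where "F \<noteq> (\<lambda>_. 0)" "real_function F" "even_function F" "polynomial_function_C F"
    "zero_set F \<subseteq> vstrip H"
    "\<not> (multiplier_op F \<nu> [:0, 1:] \<preceq>\<^sub>O multiplier_op F \<nu> ([:0, 1:] ^ 2))"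
    "\<not> (\<forall>t. multiplier_op F \<nu> ([:0, 1:] * [:t, 1:]) \<in> E2)"
proof -
  note s = alpha_sharp_bounds[OF \<nu>] and h = h_opt_sq[OF \<nu>]
  have "H\<^sup>2 > (h_opt \<nu>)\<^sup>2" using H h by (intro power_strict_mono) auto
  then have "max (-1) (1/4 - H\<^sup>2) < alpha_sharp \<nu>" using s h by simp
  \<comment> \<open>Slightly beyond the threshold, still inside the wider strip, and above -1, where
    the sign of the quartic is known and \<alpha> + 2 is positive.\<close>
  then obtain \<alpha> where \<alpha>: "-1 < \<alpha>" "1/4 - H\<^sup>2 < \<alpha>" "\<alpha> < alpha_sharp \<nu>"
    using dense[of "max (-1) (1/4 - H\<^sup>2)" "alpha_sharp \<nu>"] by auto
  define x where "x = \<alpha> / (\<alpha> + 2)"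
  have x: "x < 0" "\<alpha> = x * (\<alpha> + 2)" "\<alpha> + 6 = (3 - 2 * x) * (\<alpha> + 2)"
    using \<alpha> s by (auto simp: x_def field_simps)
  \<comment> \<open>The larger branch decides: a simple zero violates the bound when it is
    \<open>alpha_sing\<close>, a double one when it is \<open>alpha_rep\<close>.\<close>
  have "\<exists>k>0. (3 - 2 * x) ^ k * ratio_quad \<nu> (x ^ k) > (1 + \<nu>) * x ^ k"
  proof (cases "alpha_rep \<nu> \<le> alpha_sing \<nu>")
    case True
    then have "\<alpha> * (2 + \<nu>) < 2 * (\<nu> - 2)"
      using \<alpha> \<nu> by (simp add: alpha_sharp_def alpha_sing_def field_simps)
    then have "2 - \<nu> + 2 * \<nu> * x < 0" using \<alpha> by (simp add: x_def field_simps)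
    then have "3 * (1 - x)\<^sup>2 * (2 - \<nu> + 2 * \<nu> * x) < 0" using x by (intro mult_pos_neg) auto
    then show ?thesis unfolding single_residual[symmetric] by (intro exI[of _ 1]) auto
  next
    case False
    then have "rep_poly \<nu> \<alpha> < 0"
      using \<alpha> by (intro rep_poly_neg[OF \<nu>]) (auto simp: alpha_sharp_def)
    then have "((1 + \<nu>) * x\<^sup>2 - (3 - 2 * x)\<^sup>2 * ratio_quad \<nu> (x\<^sup>2)) * (\<alpha> + 2) ^ 6 < 0"
      using double_residual[of \<alpha> x \<nu>] \<alpha> by (simp add: x_def)
    then have "(1 + \<nu>) * x\<^sup>2 - (3 - 2 * x)\<^sup>2 * ratio_quad \<nu> (x\<^sup>2) < 0"
      using \<alpha> by (simp add: mult_less_0_iff)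
    then show ?thesis by (intro exI[of _ 2]) auto
  qed
  then obtain k where k: "k > 0" "(3 - 2 * x) ^ k * ratio_quad \<nu> (x ^ k) > (1 + \<nu>) * x ^ k" by blast
  define c where "c = 1/4 - \<alpha>"
  define F :: "complex \<Rightarrow> complex" where "F u = (u\<^sup>2 - of_real c) ^ k" for u
  have "F (of_real v) = of_real ((v\<^sup>2 - c) ^ k)" for v by (simp add: F_def)
  from this[of "1/2"] this[of "3/2"] this[of "5/2"]
  have F: "F (1/2) = of_real (\<alpha> ^ k)" "F (3/2) = of_real ((\<alpha> + 2) ^ k)" "F (5/2) = of_real ((\<alpha> + 6) ^ k)"
    by (simp_all add: c_def power2_eq_square add.commute)
  define A where "A = (\<alpha> + 2) ^ k"
  have A: "A \<noteq> 0" using \<alpha> by (simp add: A_def)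
  have vals: "Re (F (1/2)) = A * x ^ k" "Re (F (3/2)) = A" "Re (F (5/2)) = A * (3 - 2 * x) ^ k"
    unfolding F A_def power_mult_distrib[symmetric] mult.commute[of "\<alpha> + 2"] x(2,3)[symmetric] by simp_all
  have pos: "(3 - 2 * x) ^ k > 0" using x by simp
  have "F = poly ([:- of_real c, 0, 1:] ^ k)" by (auto simp: F_def power2_eq_square algebra_simps)
  then have "polynomial_function_C F" unfolding polynomial_function_C_def by blast
  moreover have "zero_set F \<subseteq> vstrip H"
  proof
    fix u assume "u \<in> zero_set F"
    then have u: "u\<^sup>2 = of_real c" using k(1) by (simp add: zero_set_def F_def)
    have c: "c > 0" "c < H\<^sup>2" using \<alpha> s by (auto simp: c_def)
    have "u\<^sup>2 = (of_real (sqrt c))\<^sup>2" using c u by (simp flip: of_real_power)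
    then have "u = of_real (sqrt c) \<or> u = - of_real (sqrt c)" by (simp only: power2_eq_iff)
    then have "\<bar>Re u\<bar> = sqrt c" using c by auto
    also have "\<dots> \<le> H" using c H h by (intro real_le_lsqrt) auto
    finally show "u \<in> vstrip H" by (simp add: vstrip_def)
  qed
  moreover have "real_function F" "even_function F"
    by (simp_all add: real_function_def even_function_def F_def)
  moreover have "F \<noteq> (\<lambda>_. 0)" using vals(2) A by auto
  ultimately show thesis
    using that multiplier_fails[where F = F, OF \<nu>(1) A pos k(2) vals] by blast
qed

theorem theorem6p1:
  fixes \<nu> :: real
  assumes "0 < \<nu>" and "\<nu> < 2"
  shows
    "(\<forall>F :: complex \<Rightarrow> complex.
        F \<noteq> (\<lambda>_. 0) \<and> real_function F \<and> even_function F \<and>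
        (polynomial_function_C F \<or> (F holomorphic_on UNIV \<and> growth_order F \<le> 1)) \<and>
        zero_set F \<subseteq> vstrip (h_opt \<nu>) \<longrightarrow>
          (\<forall>t :: real. multiplier_op F \<nu> ([:0, 1:] * [:t, 1:]) \<in> E2) \<and>
          multiplier_op F \<nu> [:0, 1:] \<preceq>\<^sub>O multiplier_op F \<nu> ([:0, 1:] ^ 2)) \<and>
     (\<forall>H :: real. H > h_opt \<nu> \<longrightarrow>
        (\<exists>F :: complex \<Rightarrow> complex.
           F \<noteq> (\<lambda>_. 0) \<and> real_function F \<and> even_function F \<and> polynomial_function_C F \<and>
           zero_set F \<subseteq> vstrip H \<and>
           \<not> (multiplier_op F \<nu> [:0, 1:] \<preceq>\<^sub>O multiplier_op F \<nu> ([:0, 1:] ^ 2)) \<and>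
           \<not> (\<forall>t :: real. multiplier_op F \<nu> ([:0, 1:] * [:t, 1:]) \<in> E2))) \<and>
     (alpha_rep \<nu> = alpha_sing \<nu> \<longleftrightarrow> \<nu> = (sqrt 17 - 1) / 4) \<and>
     alpha_rep ((sqrt 17 - 1) / 4) = alpha_sing ((sqrt 17 - 1) / 4) \<and>
     h_opt \<nu> = (if \<nu> \<le> (sqrt 17 - 1) / 4
                then sqrt (1/4 - alpha_rep \<nu>)
                else sqrt (1/4 - 2 * (\<nu> - 2) / (\<nu> + 2))) \<and>
     \<bar>h_opt (1/2) - 1.065615\<bar> < 0.0000005 \<and>
     h_opt (3/2) = sqrt (15/28)"
proof (intro conjI)
  show "\<forall>F :: complex \<Rightarrow> complex.
        F \<noteq> (\<lambda>_. 0) \<and> real_function F \<and> even_function F \<and>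
        (polynomial_function_C F \<or> (F holomorphic_on UNIV \<and> growth_order F \<le> 1)) \<and>
        zero_set F \<subseteq> vstrip (h_opt \<nu>) \<longrightarrow>
          (\<forall>t :: real. multiplier_op F \<nu> ([:0, 1:] * [:t, 1:]) \<in> E2) \<and>
          multiplier_op F \<nu> [:0, 1:] \<preceq>\<^sub>O multiplier_op F \<nu> ([:0, 1:] ^ 2)"
    using multiplier_in_E2[OF assms] by blast
  show "\<forall>H :: real. H > h_opt \<nu> \<longrightarrow>
        (\<exists>F :: complex \<Rightarrow> complex.
           F \<noteq> (\<lambda>_. 0) \<and> real_function F \<and> even_function F \<and> polynomial_function_C F \<and>
           zero_set F \<subseteq> vstrip H \<and>
           \<not> (multiplier_op F \<nu> [:0, 1:] \<preceq>\<^sub>O multiplier_op F \<nu> ([:0, 1:] ^ 2)) \<and>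
           \<not> (\<forall>t :: real. multiplier_op F \<nu> ([:0, 1:] * [:t, 1:]) \<in> E2))"
    using sharpness_witness[OF assms] by metis
  show "alpha_rep \<nu> = alpha_sing \<nu> \<longleftrightarrow> \<nu> = (sqrt 17 - 1) / 4"
    by (rule alpha_rep_eq_sing_iff[OF assms])
  show "alpha_rep ((sqrt 17 - 1) / 4) = alpha_sing ((sqrt 17 - 1) / 4)"
    using nu0_bounds by (subst alpha_rep_eq_sing_iff) auto
qed (rule h_opt_branches[OF assms] h_opt_half h_opt_three_halves)+

end
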